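(* Let $B,C$ be finite-dimensional quantum systems with dimension $d_B$ of $B$, and let $\rho^{BC}$ be a quantum state such that either $d_B=3$ and $\rho^{BC}$ has rank at most $2$, or $d_B=2$ and $\rho^{BC}$ has rank at most $3$ (the dimension of $C$ is arbitrary). Let $|\psi\rangle^{ABC}$ be a purification of $\rho^{BC}$ whose purifying system $A$ has dimension equal to the rank of $\rho^{BC}$, and let $\rho^{AB}=\mathrm{Tr}_C|\psi\rangle\langle\psi|^{ABC}$. Then the geometric entanglement of $\rho^{BC}$ is given by the semidefinite program $$E_g(\rho^{BC})=1-\max_{X^{AB}}\mathrm{Tr}\left[X^{AB}\rho^{AB}\right],$$ where the maximum is over all matrices $X^{AB}$ on $AB$ satisfying $$X^{AB}\ge 0,\qquad X^{T_B}\ge 0,\qquad X^A=\mathbb{1}_A .$$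
   Context: $X^{T_B}$ denotes the partial transpose of $X^{AB}$ with respect to $B$, and $X^A=\mathrm{Tr}_B[X^{AB}]$. Geometric entanglement: for a pure bipartite state $|\phi\rangle^{BC}$ with $\phi=|\phi\rangle\langle\phi|$, $E_g(\phi)=1-\max|\langle\chi|\phi\rangle|^2$, the maximum being over all normalized product vectors $|\chi\rangle=|\chi_1\rangle^B\otimes|\chi_2\rangle^C$. For a mixed state $\rho^{BC}$, $E_g(\rho^{BC})=\min\sum_i p_iE_g(\psi_i)$, the minimum being over all pure state decompositions $\rho^{BC}=\sum_i p_i|\psi_i\rangle\langle\psi_i|$ with probabilities $p_i$ and normalized $|\psi_i\rangle$. *)

theory Defs
  imports "HOL-Analysis.Analysis"
begin

type_synonym 'n cvec = "complex ^ 'n"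
type_synonym 'n cmat = "complex ^ 'n ^ 'n"

definition braket :: "'n::finite cvec \<Rightarrow> 'n cvec \<Rightarrow> complex" where
  "braket u v = (\<Sum>i\<in>UNIV. cnj (u $ i) * v $ i)"

definition projector :: "'n::finite cvec \<Rightarrow> 'n cmat" where
  "projector \<psi> = (\<chi> i j. \<psi> $ i * cnj (\<psi> $ j))"

definition tensor_vec :: "'b::finite cvec \<Rightarrow> 'c::finite cvec \<Rightarrow> ('b \<times> 'c) cvec" where
  "tensor_vec u v = (\<chi> p. u $ fst p * v $ snd p)"

definition psd :: "'n::finite cmat \<Rightarrow> bool" where
  "psd M \<longleftrightarrow> (\<forall>i j. M $ i $ j = cnj (M $ j $ i)) \<and> (\<forall>v. 0 \<le> Re (braket v (M *v v)))"

definition quantum_state :: "'n::finite cmat \<Rightarrow> bool" where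
  "quantum_state \<rho> \<longleftrightarrow> psd \<rho> \<and> trace \<rho> = 1"

definition ptrace_fst :: "('a::finite \<times> 'b::finite) cmat \<Rightarrow> 'b cmat" where
  "ptrace_fst M = (\<chi> i j. \<Sum>a\<in>UNIV. M $ (a, i) $ (a, j))"

definition ptrace_snd :: "('a::finite \<times> 'b::finite) cmat \<Rightarrow> 'a cmat" where
  "ptrace_snd M = (\<chi> i j. \<Sum>b\<in>UNIV. M $ (i, b) $ (j, b))"

(* Partial trace over the last of three tensor factors; 'a \<times> 'b \<times> 'c is 'a \<times> ('b \<times> 'c). *)
definition ptrace_third ::
    "('a::finite \<times> 'b::finite \<times> 'c::finite) cmat \<Rightarrow> ('a \<times> 'b) cmat" where
  "ptrace_third M = (\<chi> p q. \<Sum>c\<in>UNIV. M $ (fst p, snd p, c) $ (fst q, snd q, c))"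

definition ptranspose_snd :: "('a::finite \<times> 'b::finite) cmat \<Rightarrow> ('a \<times> 'b) cmat" where
  "ptranspose_snd M = (\<chi> p q. M $ (fst p, snd q) $ (fst q, snd p))"

(* Purification of a state of the composite system BC, with purifying system A. *)
definition is_purification ::
    "('a::finite \<times> 'b::finite \<times> 'c::finite) cvec \<Rightarrow> ('b \<times> 'c) cmat \<Rightarrow> bool" where
  "is_purification \<psi> \<rho> \<longleftrightarrow> norm \<psi> = 1 \<and> ptrace_fst (projector \<psi>) = \<rho>"

definition product_overlaps :: "('b::finite \<times> 'c::finite) cvec \<Rightarrow> real set" where
  "product_overlaps \<phi> =
     {(cmod (braket (tensor_vec u v) \<phi>))\<^sup>2 | u v. norm u = 1 \<and> norm v = 1}"

(* The supremum is a maximum: see geom_ent_pure_attained. *)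
definition geom_ent_pure :: "('b::finite \<times> 'c::finite) cvec \<Rightarrow> real" where
  "geom_ent_pure \<phi> = 1 - Sup (product_overlaps \<phi>)"

lemma geom_ent_pure_attained:
  fixes \<phi> :: "('b::finite \<times> 'c::finite) cvec"
  shows "\<exists>m\<in>product_overlaps \<phi>. (\<forall>r\<in>product_overlaps \<phi>. r \<le> m) \<and> geom_ent_pure \<phi> = 1 - m"
proof -
  define S where "S = sphere (0::'b cvec) 1 \<times> sphere (0::'c cvec) 1"
  define f where "f z = (cmod (braket (tensor_vec (fst z) (snd z)) \<phi>))\<^sup>2"
    for z :: "'b cvec \<times> 'c cvec"
  have "compact S"
    unfolding S_def by (intro compact_Times compact_sphere)
  moreover have "S \<noteq> {}"
    unfolding S_def by simp
  moreover have "continuous_on S f"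
    unfolding f_def braket_def tensor_vec_def by (simp, intro continuous_intros)
  ultimately obtain z where z: "z \<in> S" "\<forall>y\<in>S. f y \<le> f z"
    using continuous_attains_sup by blast
  have img: "product_overlaps \<phi> = f ` S"
    unfolding product_overlaps_def S_def f_def by (auto simp: image_iff) (metis mem_sphere_0)+
  have "Sup (f ` S) = f z"
    using z by (intro cSup_eq_maximum) auto
  then show ?thesis
    using z img unfolding geom_ent_pure_def by auto
qed

definition pure_decomposition ::
    "'n::finite cmat \<Rightarrow> nat \<Rightarrow> (nat \<Rightarrow> real) \<Rightarrow> (nat \<Rightarrow> 'n cvec) \<Rightarrow> bool" where
  "pure_decomposition \<rho> n p \<psi> \<longleftrightarrow>
     (\<forall>i<n. 0 \<le> p i) \<and> (\<Sum>i<n. p i) = 1 \<and> (\<forall>i<n. norm (\<psi> i) = 1) \<and>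
     \<rho> = (\<Sum>i<n. p i *\<^sub>R projector (\<psi> i))"

definition average_geom_ents :: "('b::finite \<times> 'c::finite) cmat \<Rightarrow> real set" where
  "average_geom_ents \<rho> =
     {\<Sum>i<n. p i * geom_ent_pure (\<psi> i) | n p \<psi>. pure_decomposition \<rho> n p \<psi>}"

(* The infimum is a minimum as soon as \<rho> has a decomposition: see geom_ent_attained. *)
definition geom_ent :: "('b::finite \<times> 'c::finite) cmat \<Rightarrow> real" where
  "geom_ent \<rho> = Inf (average_geom_ents \<rho>)"

lemma geom_ent_attained:
  fixes \<rho> :: "('b::finite \<times> 'c::finite) cmat"
  assumes "pure_decomposition \<rho> n0 p0 \<psi>0"
  shows "geom_ent \<rho> \<in> average_geom_ents \<rho> \<and> (\<forall>r\<in>average_geom_ents \<rho>. geom_ent \<rho> \<le> r)"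
proof -
  define S where
    "S = sphere (0::('b \<times> 'c) cvec) 1 \<times> sphere (0::'b cvec) 1 \<times> sphere (0::'c cvec) 1"
  define f where "f z = (projector (fst z),
      1 - (cmod (braket (tensor_vec (fst (snd z)) (snd (snd z))) (fst z)))\<^sup>2)"
    for z :: "('b \<times> 'c) cvec \<times> 'b cvec \<times> 'c cvec"
  define H where "H = convex hull (f ` S)"
  have "compact S"
    unfolding S_def by (intro compact_Times compact_sphere)
  moreover have "continuous_on S f"
    unfolding f_def braket_def tensor_vec_def projector_def by (simp, intro continuous_intros)
  ultimately have "compact H"
    unfolding H_def by (intro compact_convex_hull compact_continuous_image)
  have pure_in: "(projector \<phi>, geom_ent_pure \<phi>) \<in> f ` S" if n: "norm \<phi> = 1" for \<phi>
  proof -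
    obtain u v where "norm u = 1" "norm v = 1"
      "geom_ent_pure \<phi> = 1 - (cmod (braket (tensor_vec u v) \<phi>))\<^sup>2"
      using geom_ent_pure_attained[of \<phi>] unfolding product_overlaps_def by auto
    then show ?thesis
      using n by (intro image_eqI[of _ _ "(\<phi>, u, v)"]) (auto simp: f_def S_def)
  qed
  have in_H: "(\<rho>, r) \<in> H" if mem: "r \<in> average_geom_ents \<rho>" for r
  proof -
    obtain n p \<psi> where r: "r = (\<Sum>i<n. p i * geom_ent_pure (\<psi> i))"
      and d: "pure_decomposition \<rho> n p \<psi>"
      using mem unfolding average_geom_ents_def by blast
    have "(\<Sum>i\<in>{..<n}. p i *\<^sub>R (projector (\<psi> i), geom_ent_pure (\<psi> i))) \<in> H"
    proof (rule convex_sum)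
      show "convex H"
        unfolding H_def by (rule convex_convex_hull)
      show "(projector (\<psi> i), geom_ent_pure (\<psi> i)) \<in> H" if "i \<in> {..<n}" for i
        using d that pure_in hull_subset[of "f ` S" convex]
        unfolding H_def pure_decomposition_def by auto
    qed (use d in \<open>auto simp: pure_decomposition_def\<close>)
    moreover have "(\<Sum>i\<in>{..<n}. p i *\<^sub>R (projector (\<psi> i), geom_ent_pure (\<psi> i))) = (\<rho>, r)"
      using d unfolding r pure_decomposition_def by (auto simp: prod_eq_iff fst_sum snd_sum)
    ultimately show ?thesis
      by simp
  qed
  have "(\<Sum>i<n0. p0 i * geom_ent_pure (\<psi>0 i)) \<in> average_geom_ents \<rho>"
    using assms unfolding average_geom_ents_def by auto
  then have "(\<rho>, \<Sum>i<n0. p0 i * geom_ent_pure (\<psi>0 i)) \<in> H \<inter> (fst -` {\<rho>})"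
    using in_H by simp
  then have "H \<inter> (fst -` {\<rho>}) \<noteq> {}"
    by blast
  moreover have "compact (H \<inter> (fst -` {\<rho>}))"
    using \<open>compact H\<close> by (intro compact_Int_closed closed_vimage_fst) auto
  moreover have "continuous_on (H \<inter> (fst -` {\<rho>})) snd"
    by (intro continuous_intros)
  ultimately have "\<exists>z\<in>H \<inter> (fst -` {\<rho>}). \<forall>y\<in>H \<inter> (fst -` {\<rho>}). snd z \<le> snd y"
    by (intro continuous_attains_inf)
  then obtain z where z: "z \<in> H" "fst z = \<rho>" "\<forall>y\<in>H \<inter> (fst -` {\<rho>}). snd z \<le> snd y"
    by blast
  have min: "snd z \<le> r" if "r \<in> average_geom_ents \<rho>" for r
    using z(3) in_H[OF that] by force
  obtain k p x where px: "\<forall>i\<in>{1::nat..k}. 0 \<le> p i \<and> x i \<in> f ` S" "sum p {1..k} = 1"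
    "(\<Sum>i = 1..k. p i *\<^sub>R x i) = z"
    using z(1) unfolding H_def convex_hull_indexed by auto
  have "\<exists>\<phi>. norm \<phi> = 1 \<and> fst (x (Suc i)) = projector \<phi> \<and> geom_ent_pure \<phi> \<le> snd (x (Suc i))"
    if i: "i < k" for i
  proof -
    have "x (Suc i) \<in> f ` S"
      using px(1) i by auto
    then obtain \<phi> u v where \<phi>: "norm \<phi> = 1" "norm u = 1" "norm v = 1" "x (Suc i) = f (\<phi>, u, v)"
      unfolding S_def by auto
    have "(cmod (braket (tensor_vec u v) \<phi>))\<^sup>2 \<in> product_overlaps \<phi>"
      using \<phi> unfolding product_overlaps_def by auto
    then show ?thesis
      using geom_ent_pure_attained[of \<phi>] \<phi> by (intro exI[of _ \<phi>]) (fastforce simp: f_def)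
  qed
  then obtain \<psi> where \<psi>: "\<And>i. i < k \<Longrightarrow> norm (\<psi> i) = 1 \<and>
      fst (x (Suc i)) = projector (\<psi> i) \<and> geom_ent_pure (\<psi> i) \<le> snd (x (Suc i))"
    by metis
  have shift: "(\<Sum>i<k. g (Suc i)) = (\<Sum>i = 1..k. g i)" for g :: "nat \<Rightarrow> 'z::comm_monoid_add"
    using sum.atLeast1_atMost_eq[of g k] by simp
  have zsum: "z = (\<Sum>i<k. p (Suc i) *\<^sub>R x (Suc i))"
    using px(3) shift[of "\<lambda>i. p i *\<^sub>R x i"] by simp
  have "\<rho> = (\<Sum>i<k. p (Suc i) *\<^sub>R projector (\<psi> i))"
    using z(2) \<psi> by (auto simp: zsum fst_sum intro!: sum.cong)
  then have "pure_decomposition \<rho> k (\<lambda>i. p (Suc i)) \<psi>"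
    using px(1,2) \<psi> shift[of p] unfolding pure_decomposition_def by auto
  then have avg: "(\<Sum>i<k. p (Suc i) * geom_ent_pure (\<psi> i)) \<in> average_geom_ents \<rho>"
    unfolding average_geom_ents_def mem_Collect_eq
    by (intro exI[of _ k] exI[of _ "\<lambda>i. p (Suc i)"] exI[of _ \<psi>]) simp
  have "(\<Sum>i<k. p (Suc i) * geom_ent_pure (\<psi> i)) \<le> snd z"
    using px(1) \<psi> by (auto simp: zsum snd_sum intro!: sum_mono mult_left_mono)
  then have zin: "snd z \<in> average_geom_ents \<rho>"
    using avg min[OF avg] by simp
  then have "geom_ent \<rho> = snd z"
    unfolding geom_ent_def using min by (rule cInf_eq_minimum)
  then show ?thesis
    using zin min by simp
qed

definition sdp_feasible :: "('a::finite \<times> 'b::finite) cmat \<Rightarrow> bool" where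
  "sdp_feasible X \<longleftrightarrow> psd X \<and> psd (ptranspose_snd X) \<and> ptrace_snd X = mat 1"

end

theory Submission
  imports Defs "HOL-Computational_Algebra.Fundamental_Theorem_Algebra"
begin

text \<open>
  A measurement on the purifying system \<open>A\<close> steers the system \<open>BC\<close> into a pure state decomposition
  of \<open>\<rho>\<close>, and every decomposition arises in this way because \<open>A\<close> has no superfluous dimensions.
  Hence \<open>1 - E\<^sub>g\<close> is the maximum of the objective over the separable feasible \<open>X\<close>, and what
  remains is that in dimensions \<open>2 \<times> 2\<close> and \<open>2 \<times> 3\<close> positive partial transpose implies
  separability.

  By the Krein--Milman theorem it is enough that the ranges of a nonzero \<open>X\<close> and of its partial
  transpose contain product vectors that differ by a conjugation of one factor: such a product
  can be subtracted, so an extreme point is a product.  Compressing and rescaling brings \<open>X\<close> to the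
  block form \<open>[[A, B], [B*, 1]]\<close>; with \<open>P = A - B B*\<close> and \<open>Q = A - B* B\<close>, which are positive, one
  needs a common vector in the ranges of \<open>P\<close> and \<open>Q\<close>, or \<open>z\<close> and \<open>f \<noteq> 0\<close> with
  \<open>(z - B) f\<close> in the range of \<open>P\<close> and \<open>(z - B)* f\<close> in the range of \<open>Q\<close>.
  If \<open>P = Q = 0\<close>, then \<open>B\<close> is normal and \<open>f\<close> is an eigenvector.  If both ranks are one, then \<open>B\<close>
  has a normal dilation by one dimension, and \<open>f\<close> is the compression of an eigenvector of it.  If
  the ranks are two and one, \<open>f\<close> solves a \<open>3 \<times> 3\<close> system whose determinant has leading
  term \<open>z |z|\<^sup>2\<close> up to a conjugation, and therefore a zero.
\<close>

section \<open>Positive semidefinite matrices\<close>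

definition adjm :: "complex ^ 'n ^ 'm \<Rightarrow> complex ^ 'm ^ 'n" where
  "adjm M = (\<chi> i j. cnj (M $ j $ i))"

definition outer :: "complex ^ 'm \<Rightarrow> complex ^ 'n \<Rightarrow> complex ^ 'n ^ 'm" where
  "outer p q = (\<chi> i j. p $ i * cnj (q $ j))"

lemma projector_eq_outer: "projector p = outer p p"
  by (simp add: projector_def outer_def)

lemma adjm_nth [simp]: "adjm M $ i $ j = cnj (M $ j $ i)"
  by (simp add: adjm_def)

lemma adjm_adjm [simp]: "adjm (adjm M) = M"
  by (simp add: vec_eq_iff)

lemma adjm_mult: "adjm (M ** N) = adjm N ** adjm M"
  for M :: "complex ^ 'n::finite ^ 'm::finite"
  by (simp add: vec_eq_iff matrix_matrix_mult_def mult.commute)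

lemma adjm_add: "adjm (M + N) = adjm M + adjm N"
  and adjm_diff: "adjm (M - N) = adjm M - adjm N"
  by (simp_all add: vec_eq_iff)

lemma adjm_scaleR: "adjm (c *\<^sub>R M) = c *\<^sub>R adjm M"
  by (simp add: vec_eq_iff)

lemma scaleR_matrix_vector: "(c *\<^sub>R M) *v v = of_real c *s (M *v v)"
  for M :: "complex ^ 'n::finite ^ 'm::finite"
proof -
  have "(\<Sum>j\<in>UNIV. c *\<^sub>R f j) = of_real c * (\<Sum>j\<in>UNIV. f j)" for f :: "'n \<Rightarrow> complex"
    by (simp add: scaleR_conv_of_real sum_distrib_left)
  then show ?thesis by (simp add: vec_eq_iff matrix_vector_mult_def)
qed

lemma adjm_mat1 [simp]: "adjm (mat 1) = mat 1"
  by (auto simp: vec_eq_iff mat_def)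

lemma adjm_outer [simp]: "adjm (outer p q) = outer q p"
  by (simp add: vec_eq_iff outer_def mult.commute)

lemma braket_add_right: "braket u (v + w) = braket u v + braket u w"
  and braket_add_left: "braket (u + v) w = braket u w + braket v w"
  and braket_diff_right: "braket u (v - w) = braket u v - braket u w"
  and braket_diff_left: "braket (u - v) w = braket u w - braket v w"
  and braket_scale_right: "braket u (c *s v) = c * braket u v"
  and braket_scale_left: "braket (c *s u) v = cnj c * braket u v"
  by (simp_all add: braket_def algebra_simps sum.distrib sum_subtractf sum_distrib_left)

lemma braket_zero_left [simp]: "braket 0 v = 0"
  and braket_zero_right [simp]: "braket u 0 = 0"
  by (simp_all add: braket_def)

lemmas braket_linear = braket_add_right braket_add_left braket_diff_right braket_diff_left
  braket_scale_right braket_scale_left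

lemma braket_sum_right: "braket u (\<Sum>i\<in>S. f i) = (\<Sum>i\<in>S. braket u (f i))"
  by (induction S rule: infinite_finite_induct) (simp_all add: braket_linear)

lemma cnj_braket [simp]: "cnj (braket u v) = braket v u"
  by (simp add: braket_def mult.commute)

lemma braket_adjm: "braket u (M *v w) = braket (adjm M *v u) w"
  for M :: "complex ^ 'n::finite ^ 'm::finite"
proof -
  have "braket u (M *v w) = (\<Sum>i\<in>UNIV. \<Sum>j\<in>UNIV. cnj (u $ i) * (M $ i $ j * w $ j))"
    by (simp add: braket_def matrix_vector_mult_def sum_distrib_left)
  also have "\<dots> = (\<Sum>j\<in>UNIV. \<Sum>i\<in>UNIV. cnj (u $ i) * (M $ i $ j * w $ j))"
    by (rule sum.swap)
  also have "\<dots> = braket (adjm M *v u) w"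
    by (simp add: braket_def matrix_vector_mult_def sum_distrib_left mult_ac)
  finally show ?thesis .
qed

lemma braket_adjm': "braket (M *v u) w = braket u (adjm M *v w)"
  for M :: "complex ^ 'n::finite ^ 'm::finite"
  by (simp add: braket_adjm)

lemma braket_self: "braket u u = of_real ((norm u)\<^sup>2)"
proof -
  have "cnj z * z = of_real ((cmod z)\<^sup>2)" for z
    by (metis complex_norm_square mult.commute)
  then show ?thesis
    by (simp add: braket_def norm_vec_def L2_set_def sum_nonneg)
qed

lemma braket_self_eq_0 [simp]: "braket u u = 0 \<longleftrightarrow> u = 0"
  by (simp add: braket_self)

lemma cmod_braket_le: "cmod (braket u v) \<le> norm u * norm v"
proof -
  have "cmod (braket u v) \<le> (\<Sum>i\<in>UNIV. \<bar>norm (u $ i)\<bar> * \<bar>norm (v $ i)\<bar>)"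
    unfolding braket_def by (rule order_trans[OF norm_sum]) (simp add: norm_mult)
  also have "\<dots> \<le> norm u * norm v"
    unfolding norm_vec_def by (rule L2_set_mult_ineq)
  finally show ?thesis .
qed

lemma outer_mult_vec [simp]: "outer p q *v x = braket q x *s p"
  by (simp add: vec_eq_iff outer_def matrix_vector_mult_def braket_def sum_distrib_right mult_ac
      sum_distrib_left)

lemma mult_outer: "M ** outer p q = outer (M *v p) q"
  by (simp add: vec_eq_iff outer_def matrix_matrix_mult_def matrix_vector_mult_def
      sum_distrib_left sum_distrib_right mult_ac)

lemma outer_mult: "outer p q ** M = outer p (adjm M *v q)"
  by (simp add: vec_eq_iff outer_def matrix_matrix_mult_def matrix_vector_mult_def
      sum_distrib_left mult_ac)

lemma trace_outer: "trace (outer p q) = braket q p"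
  by (simp add: trace_def outer_def braket_def mult_ac)

section \<open>Positivity: Cauchy-Schwarz, kernels, traces and rank-one subtraction\<close>

lemma adjm_psd: "psd M \<Longrightarrow> adjm M = M"
  unfolding psd_def vec_eq_iff adjm_nth by metis

lemma psd_sym: "psd M \<Longrightarrow> braket (M *v u) v = braket u (M *v v)"
  by (simp add: braket_adjm' adjm_psd)

lemma psdI:
  assumes "adjm M = M" "\<And>v. 0 \<le> Re (braket v (M *v v))"
  shows "psd M"
  unfolding psd_def
proof (intro conjI allI)
  show "M $ i $ j = cnj (M $ j $ i)" for i j
    using arg_cong[OF assms(1), of "\<lambda>M. M $ i $ j"] by simp
qed (fact assms(2))

lemma psd_braket_real: "psd M \<Longrightarrow> braket v (M *v v) = of_real (Re (braket v (M *v v)))"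
proof -
  assume "psd M"
  then have "cnj (braket v (M *v v)) = braket v (M *v v)" by (simp add: psd_sym)
  then have "Im (braket v (M *v v)) = 0" by (metis Reals_cnj_iff complex_is_Real_iff)
  then show ?thesis by (simp add: complex_eq_iff)
qed

lemma psd_nonneg: "psd M \<Longrightarrow> 0 \<le> Re (braket v (M *v v))"
  by (simp add: psd_def)

lemma psd_Cauchy_Schwarz:
  assumes "psd M"
  shows "(cmod (braket u (M *v v)))\<^sup>2 \<le> Re (braket u (M *v u)) * Re (braket v (M *v v))"
proof -
  define U V z where "U = Re (braket u (M *v u))" and "V = Re (braket v (M *v v))"
    and "z = braket u (M *v v)"
  have z': "braket v (M *v u) = cnj z"
    unfolding z_def using psd_sym[OF assms] by (metis cnj_braket)
  have ge: "0 \<le> U - 2 * r * (cmod z)\<^sup>2 + r\<^sup>2 * (cmod z)\<^sup>2 * V" for r :: real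
  proof -
    \<comment> \<open>The phase of \<open>t\<close> makes both cross terms equal to -r |z|^2, so
      that positivity at u + t v becomes an inequality for a real quadratic polynomial in
      \<open>r\<close>.\<close>
    define t where "t = - of_real r * cnj z"
    have "0 \<le> Re (braket (u + t *s v) (M *v (u + t *s v)))"
      by (rule psd_nonneg[OF assms])
    also have "braket (u + t *s v) (M *v (u + t *s v))
        = braket u (M *v u) + t * z + cnj t * cnj z + cnj t * t * braket v (M *v v)"
      by (simp add: vec.add vec.scale braket_linear z' z_def[symmetric]) (simp add: algebra_simps)
    also have "Re \<dots> = U - 2 * r * (cmod z)\<^sup>2 + r\<^sup>2 * (cmod z)\<^sup>2 * V"
    proof -
      have zz: "z * cnj z = of_real ((cmod z)\<^sup>2)" by (metis complex_norm_square)
      have "t * z = - of_real (r * (cmod z)\<^sup>2)" "cnj t * cnj z = - of_real (r * (cmod z)\<^sup>2)"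
        "cnj t * t = of_real (r\<^sup>2 * (cmod z)\<^sup>2)"
        unfolding t_def of_real_mult zz[symmetric]
        by (simp_all add: power2_eq_square mult_ac)
      then show ?thesis by (simp add: U_def V_def)
    qed
    finally show ?thesis .
  qed
  have V0: "V \<ge> 0" unfolding V_def by (rule psd_nonneg[OF assms])
  show ?thesis
  proof (cases "V = 0")
    case True
    have "(cmod z)\<^sup>2 = 0"
    proof (rule ccontr)
      assume nz: "(cmod z)\<^sup>2 \<noteq> 0"
      \<comment> \<open>With V = 0 the inequality is linear in \<open>r\<close>, and the chosen
        value turns it into 0 \<le> -1.\<close>
      show False
        using ge[of "(U + 1) / (2 * (cmod z)\<^sup>2)"] nz True by simp
    qed
    then show ?thesis using True by (simp add: z_def V_def)
  next
    case False
    have "(1 / V)\<^sup>2 * (cmod z)\<^sup>2 * V = 1 / V * (cmod z)\<^sup>2"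
      using False by (simp add: power2_eq_square)
    then have "(cmod z)\<^sup>2 / V \<le> U"
      using ge[of "1 / V"] by simp
    then have "(cmod z)\<^sup>2 \<le> U * V"
      using False V0 by (simp add: pos_divide_le_eq)
    then show ?thesis by (simp add: z_def U_def V_def)
  qed
qed

text \<open>In Cauchy-Schwarz with left argument \<open>M *v v\<close> the right-hand side vanishes
  by assumption, while the left-hand side is |Mv|^4.\<close>

lemma psd_null:
  assumes "psd M" "Re (braket v (M *v v)) = 0"
  shows "M *v v = 0"
proof -
  have "(cmod (braket (M *v v) (M *v v)))\<^sup>2 \<le> 0"
    using psd_Cauchy_Schwarz[OF assms(1), of "M *v v" v] assms(2) by simp
  then show ?thesis by simp
qed

lemma psd_projector: "psd (projector p)"
proof (rule psdI)
  fix v :: "'a cvec"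
  have "braket v (projector p *v v) = braket p v * cnj (braket p v)"
    unfolding projector_eq_outer by (simp add: braket_linear)
  also have "\<dots> = of_real ((cmod (braket p v))\<^sup>2)"
    by (metis complex_norm_square)
  finally show "0 \<le> Re (braket v (projector p *v v))" by simp
qed (simp add: projector_eq_outer)

lemma psd_add: "psd M \<Longrightarrow> psd N \<Longrightarrow> psd (M + N)"
  by (rule psdI) (simp_all add: matrix_vector_mult_add_rdistrib braket_add_right adjm_add adjm_psd
      psd_nonneg)

lemma psd_scaleR: "psd M \<Longrightarrow> 0 \<le> c \<Longrightarrow> psd (c *\<^sub>R M)"
proof -
  assume "psd M" "0 \<le> c"
  then show ?thesis
    by (intro psdI) (simp_all add: adjm_scaleR adjm_psd scaleR_matrix_vector braket_linear psd_nonneg)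
qed

lemma psd_0 [simp]: "psd 0"
  by (rule psdI) (simp_all add: vec_eq_iff)

lemma psd_sum: "(\<And>i. i \<in> S \<Longrightarrow> psd (f i)) \<Longrightarrow> psd (\<Sum>i\<in>S. f i)"
  by (induction S rule: infinite_finite_induct) (simp_all add: psd_add)

lemma braket_axis: "braket (axis i 1) v = v $ i"
  by (simp add: braket_def axis_def if_distrib if_distribR cong: if_cong)

lemma braket_axis_matrix: "braket (axis i 1) (M *v axis j 1) = M $ i $ j"
  by (simp add: braket_axis matrix_vector_mult_def)
    (simp add: axis_def if_distrib cong: if_cong)

lemma psd_diag: "psd M \<Longrightarrow> Im (M $ i $ i) = 0 \<and> 0 \<le> Re (M $ i $ i)"
proof -
  assume M: "psd M"
  show ?thesis
    using psd_nonneg[OF M, of "axis i 1"] psd_braket_real[OF M, of "axis i 1"]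
    by (simp add: braket_axis_matrix complex_eq_iff)
qed

lemma psd_entry_bound:
  assumes "psd M"
  shows "(cmod (M $ i $ j))\<^sup>2 \<le> Re (M $ i $ i) * Re (M $ j $ j)"
  using psd_Cauchy_Schwarz[OF assms, of "axis i 1" "axis j 1"] by (simp add: braket_axis_matrix)

lemma Re_trace: "Re (trace M) = (\<Sum>i\<in>UNIV. Re (M $ i $ i))"
  by (simp add: trace_def)

lemma psd_trace_nonneg: "psd M \<Longrightarrow> 0 \<le> Re (trace M)"
  unfolding Re_trace by (intro sum_nonneg) (simp add: psd_diag)

text \<open>A 2 x 2 principal minor bounds the entry by the geometric mean of two diagonal entries,
  each at most the trace. This is what bounds the set of trace-one states.\<close>

lemma psd_entry_le_trace:
  assumes "psd M"
  shows "cmod (M $ i $ j) \<le> Re (trace M)"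
proof -
  have le: "Re (M $ k $ k) \<le> Re (trace M)" for k
    unfolding Re_trace by (rule member_le_sum) (simp_all add: psd_diag[OF assms])
  have "(cmod (M $ i $ j))\<^sup>2 \<le> (Re (trace M))\<^sup>2"
    using order_trans[OF psd_entry_bound[OF assms, of i j] mult_mono[OF le[of i] le[of j]]]
      psd_diag[OF assms] psd_trace_nonneg[OF assms]
    by (simp add: power2_eq_square)
  then show ?thesis using psd_trace_nonneg[OF assms] by (rule power2_le_imp_le)
qed

lemma psd_trace_eq_0: "psd M \<Longrightarrow> Re (trace M) = 0 \<Longrightarrow> M = 0"
  using psd_entry_le_trace[of M] by (simp add: vec_eq_iff)

text \<open>Cauchy-Schwarz for the form of \<open>M\<close> gives |<v,x>|^2 \<le> <w,Mw> <x,Mx>, so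
  every \<open>d\<close> with d <w,Mw> \<le> 1 is admissible. A whole interval is stated so that two
  such bounds can be met at once.\<close>

lemma psd_sub_range:
  assumes M: "psd M" and v: "v = M *v w"
  shows "\<exists>e>0. \<forall>d. 0 \<le> d \<and> d \<le> e \<longrightarrow> psd (M - d *\<^sub>R projector v)"
proof -
  define W where "W = Re (braket w (M *v w))"
  have W0: "W \<ge> 0" unfolding W_def by (rule psd_nonneg[OF M])
  show ?thesis
  proof (intro exI conjI allI impI)
    show "1 / (W + 1) > 0" using W0 by simp
    fix d assume d: "0 \<le> d \<and> d \<le> 1 / (W + 1)"
    show "psd (M - d *\<^sub>R projector v)"
    proof (rule psdI)
      show "adjm (M - d *\<^sub>R projector v) = M - d *\<^sub>R projector v"
        by (simp add: adjm_diff adjm_scaleR adjm_psd[OF M] projector_eq_outer)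
      fix x
      have "braket x ((M - d *\<^sub>R projector v) *v x)
          = braket x (M *v x) - of_real d * (braket v x * cnj (braket v x))"
        unfolding projector_eq_outer
        by (simp add: matrix_vector_mult_diff_rdistrib scaleR_matrix_vector braket_linear)
      also have "braket v x * cnj (braket v x) = of_real ((cmod (braket v x))\<^sup>2)"
        by (metis complex_norm_square)
      finally have eq: "Re (braket x ((M - d *\<^sub>R projector v) *v x))
          = Re (braket x (M *v x)) - d * (cmod (braket v x))\<^sup>2" by simp
      define X where "X = Re (braket x (M *v x))"
      have X0: "X \<ge> 0" unfolding X_def by (rule psd_nonneg[OF M])
      have "(cmod (braket v x))\<^sup>2 \<le> W * X"
        using psd_Cauchy_Schwarz[OF M, of w x] unfolding v W_def X_def
        by (simp add: psd_sym[OF M])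
      then have "d * (cmod (braket v x))\<^sup>2 \<le> d * (W * X)"
        using d by (simp add: mult_left_mono)
      also have "\<dots> \<le> 1 / (W + 1) * (W * X)"
        using d W0 X0 by (intro mult_right_mono) auto
      also have "\<dots> \<le> X"
        using W0 X0 by (simp add: field_simps)
      finally show "0 \<le> Re (braket x ((M - d *\<^sub>R projector v) *v x))"
        using eq X_def by simp
    qed
  qed
qed

section \<open>Eigenvectors and zeros\<close>

lemma wide_matrix_kernel:
  fixes M :: "complex ^ 'm::finite ^ 'n::finite"
  assumes "CARD('n) < CARD('m)"
  shows "\<exists>x. x \<noteq> 0 \<and> M *v x = 0"
proof (rule ccontr)
  assume "\<not> ?thesis"
  then have "inj ((*v) M)" by (auto simp: vec.inj_iff_eq_0)
  then have "vec.dim (range ((*v) M)) = vec.dim (UNIV :: (complex ^ 'm) set)"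
    using vec.dim_image_eq[of "(*v) M" UNIV] vec.linear_axioms[of M] by simp
  then show False
    using vec.dim_subset[of "range ((*v) M)" UNIV] assms
    by (simp only: vec_dim_card subset_UNIV True_implies_equals)
qed

text \<open>The vector p(A)v, with the powers of \<open>A\<close> taken as iterates of the linear
  map.\<close>

definition poly_apply :: "complex ^ 'n ^ 'n \<Rightarrow> complex poly \<Rightarrow> complex ^ 'n \<Rightarrow> complex ^ 'n" where
  "poly_apply A p v = (\<Sum>i\<le>degree p. coeff p i *s ((*v) A ^^ i) v)"

lemma poly_apply_upto:
  assumes "degree p \<le> n"
  shows "poly_apply A p v = (\<Sum>i\<le>n. coeff p i *s ((*v) A ^^ i) v)"
  unfolding poly_apply_def
  using assms by (intro sum.mono_neutral_left) (auto simp: coeff_eq_0)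

lemma poly_apply_linear_factor:
  "poly_apply A ([:-z, 1:] * q) v = poly_apply A q (A *v v - z *s v)"
proof -
  have iter: "((*v) A ^^ i) (A *v v - z *s v) = ((*v) A ^^ Suc i) v - z *s ((*v) A ^^ i) v" for i
    by (induction i) (simp_all add: vec.diff vec.scale)
  define n where "n = degree q"
  have deg: "degree ([:-z, 1:] * q) \<le> Suc n"
    unfolding n_def by (rule order_trans[OF degree_mult_le]) simp
  have "poly_apply A ([:-z, 1:] * q) v
      = (\<Sum>i\<le>Suc n. (coeff (pCons 0 q) i - z * coeff q i) *s ((*v) A ^^ i) v)"
    unfolding poly_apply_upto[OF deg] by (rule sum.cong) (simp_all add: mult_pCons_left)
  also have "\<dots> = (\<Sum>i\<le>Suc n. coeff (pCons 0 q) i *s ((*v) A ^^ i) v)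
      - (\<Sum>i\<le>Suc n. (z * coeff q i) *s ((*v) A ^^ i) v)"
    by (simp only: vec.scale_left_diff_distrib sum_subtractf)
  also have "(\<Sum>i\<le>Suc n. coeff (pCons 0 q) i *s ((*v) A ^^ i) v)
      = (\<Sum>i\<le>n. coeff q i *s ((*v) A ^^ Suc i) v)"
    by (subst sum.atMost_Suc_shift) simp
  also have "(\<Sum>i\<le>Suc n. (z * coeff q i) *s ((*v) A ^^ i) v)
      = (\<Sum>i\<le>n. (z * coeff q i) *s ((*v) A ^^ i) v)"
    by (simp add: n_def coeff_eq_0)
  finally show ?thesis
    unfolding poly_apply_upto[OF eq_refl[OF n_def[symmetric]]] iter
    by (simp add: sum_subtractf[symmetric] vec.scale_right_diff_distrib mult.commute)
qed

text \<open>Split off a root z, p = (X - z) q. Either \<open>v\<close> is an eigenvector for z, or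
  Av - zv is a nonzero vector annihilated by \<open>q\<close>, which has smaller degree. Degree zero
  is impossible.\<close>

lemma eigenvector_if_annihilated:
  "p \<noteq> 0 \<Longrightarrow> v \<noteq> 0 \<Longrightarrow> poly_apply A p v = 0 \<Longrightarrow> \<exists>z w. w \<noteq> 0 \<and> A *v w = z *s w"
proof (induction "degree p" arbitrary: p v)
  case 0
  then have "coeff p 0 \<noteq> 0" by (metis leading_coeff_0_iff)
  then show ?case using 0 by (simp add: poly_apply_def)
next
  case (Suc d)
  then have "\<not> constant (poly p)" by (simp add: constant_degree)
  then obtain z where "poly p z = 0" using fundamental_theorem_of_algebra by blast
  then obtain q where q: "p = [:-z, 1:] * q" by (auto simp: poly_eq_0_iff_dvd)
  then have q0: "q \<noteq> 0" using Suc.prems(1) by auto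
  have "degree p = 1 + degree q"
    unfolding q using q0 by (subst degree_mult_eq) auto
  then have d: "d = degree q" using Suc.hyps(2) by simp
  have ann: "poly_apply A q (A *v v - z *s v) = 0"
    using Suc.prems(3) unfolding q poly_apply_linear_factor .
  show ?case
  proof (cases "A *v v - z *s v = 0")
    case True
    then show ?thesis using Suc.prems(2) by auto
  qed (use Suc.hyps(1)[OF d q0 _ ann] in blast)
qed

text \<open>The N + 1 vectors v, Av, ..., A^N v of an N-dimensional space are dependent, and the
  coefficients of a relation form an annihilating polynomial. The option type indexes these N + 1
  vectors.\<close>

lemma eigenvector_exists:
  fixes A :: "complex ^ 'n::finite ^ 'n"
  shows "\<exists>z w. w \<noteq> 0 \<and> A *v w = z *s w"
proof -
  define N where "N = CARD('n)"
  have "card (UNIV :: 'n option set) = card {..N}"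
    by (simp add: N_def card_UNIV_option)
  then obtain h :: "'n option \<Rightarrow> nat" where h: "bij_betw h UNIV {..N}"
    using finite_same_card_bij[of "UNIV :: 'n option set" "{..N}"] by auto
  define v :: "complex ^ 'n" where "v = 1"
  define M :: "complex ^ 'n option ^ 'n" where "M = (\<chi> i k. (((*v) A ^^ h k) v) $ i)"
  obtain x where x: "x \<noteq> 0" "M *v x = 0"
    using wide_matrix_kernel[of M] by (auto simp: card_UNIV_option)
  define g where "g = inv_into UNIV h"
  define p where "p = (\<Sum>i\<le>N. monom (x $ g i) i)"
  have cp: "coeff p i = (if i \<le> N then x $ g i else 0)" for i
    by (simp add: p_def coeff_sum)
  have gh: "g (h k) = k" "h k \<le> N" for k
    using h unfolding g_def bij_betw_def by (auto intro: inv_into_f_f)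
  obtain k where "x $ k \<noteq> 0" using x(1) by (auto simp: vec_eq_iff)
  then have "coeff p (h k) \<noteq> 0" by (simp add: cp gh)
  then have p0: "p \<noteq> 0" by auto
  have "degree p \<le> N" by (rule degree_le) (simp add: cp)
  then have "poly_apply A p v = (\<Sum>i\<le>N. x $ g i *s ((*v) A ^^ i) v)"
    by (simp add: poly_apply_upto cp)
  also have "\<dots> = (\<Sum>k\<in>UNIV. x $ k *s ((*v) A ^^ h k) v)"
    by (subst sum.reindex_bij_betw[OF h, symmetric]) (simp add: gh)
  also have "\<dots> = M *v x"
    by (simp add: vec_eq_iff M_def matrix_vector_mult_def mult.commute)
  finally have "poly_apply A p v = 0" using x by simp
  moreover have "v \<noteq> 0" by (simp add: v_def)
  ultimately show ?thesis using eigenvector_if_annihilated p0 by blast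
qed

text \<open>Normality gives \<open>N *v w\<close> and \<open>adjm N *v w\<close> the same norm;
  expanding the squared norm of \<open>adjm N *v w - cnj z *s w\<close> then yields zero.\<close>

lemma normal_eigenvector:
  fixes N :: "complex ^ 'n::finite ^ 'n"
  assumes normal: "adjm N ** N = N ** adjm N" and eig: "N *v w = z *s w"
  shows "adjm N *v w = cnj z *s w"
proof -
  have "braket (adjm N *v w) (adjm N *v w) = braket w ((N ** adjm N) *v w)"
    by (simp add: braket_adjm' flip: matrix_vector_mul_assoc)
  also have "\<dots> = braket (N *v w) (N *v w)"
    by (simp add: braket_adjm' flip: normal matrix_vector_mul_assoc)
  finally have "braket (adjm N *v w) (adjm N *v w) = z * cnj z * braket w w"
    by (simp add: eig braket_linear)
  moreover have "braket w (adjm N *v w) = cnj z * braket w w"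
    using eig by (simp add: braket_adjm braket_linear)
  moreover have "braket (adjm N *v w) w = z * braket w w"
    using eig by (simp add: braket_adjm' braket_linear)
  ultimately have "braket (adjm N *v w - cnj z *s w) (adjm N *v w - cnj z *s w) = 0"
    by (simp add: braket_linear algebra_simps)
  then show ?thesis by simp
qed

text \<open>The map \<open>z \<mapsto> z * |z|^2\<close> has winding number one around the origin at infinity, so by
  Brouwer's theorem it stays onto under perturbations of lower order.\<close>

lemma perturbed_cube_zero:
  fixes E :: "complex \<Rightarrow> complex"
  assumes cont: "continuous_on UNIV E" and bound: "\<And>z. cmod (E z) \<le> C * (1 + cmod z)\<^sup>2"
  shows "\<exists>z. z * of_real ((cmod z)\<^sup>2) + E z = 0"
proof -
  have C0: "C \<ge> 0" using bound[of 0] norm_ge_zero[of "E 0"] by (simp del: norm_ge_zero)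
  \<comment> \<open>For |z| at least \<open>r0\<close> the cubic term dominates the bound on
    \<open>E\<close>. Below \<open>r0\<close> one step adds at most C (1 + r0)^2 to the modulus, and
    \<open>R\<close> leaves room for that.\<close>
  define r0 where "r0 = 4 * C + 1"
  define R where "R = r0 + C * (1 + r0)\<^sup>2 + 1"
  have R: "R \<ge> 1" using C0 by (simp add: R_def r0_def)
  \<comment> \<open>Fixed points of \<open>h\<close> are the zeros sought; the step size 1/R^2 keeps
    the factor 1 - |z|^2/R^2 nonnegative on the ball.\<close>
  define h where "h z = z - of_real (1 / R\<^sup>2) * (z * of_real ((cmod z)\<^sup>2) + E z)" for z
  have "h z \<in> cball 0 R" if z: "z \<in> cball 0 R" for z
  proof -
    define r where "r = cmod z"
    have r: "0 \<le> r" "r \<le> R" using z by (simp_all add: r_def)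
    have "h z = z * of_real (1 - r\<^sup>2 / R\<^sup>2) - of_real (1 / R\<^sup>2) * E z"
      by (simp add: h_def r_def algebra_simps)
    then have "cmod (h z) \<le> cmod (z * of_real (1 - r\<^sup>2 / R\<^sup>2)) + cmod (of_real (1 / R\<^sup>2) * E z)"
      by (simp only: norm_triangle_ineq4)
    also have "cmod (z * of_real (1 - r\<^sup>2 / R\<^sup>2)) = r * (1 - r\<^sup>2 / R\<^sup>2)"
      using r R by (simp only: norm_mult norm_of_real r_def) (simp add: power_mono)
    also have "cmod (of_real (1 / R\<^sup>2) * E z) = 1 / R\<^sup>2 * cmod (E z)"
      by (simp only: norm_mult norm_of_real) simp
    also have "\<dots> \<le> 1 / R\<^sup>2 * (C * (1 + r)\<^sup>2)"
      unfolding r_def by (intro mult_left_mono bound) simp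
    finally have le: "cmod (h z) \<le> r + (C * (1 + r)\<^sup>2 - r ^ 3) / R\<^sup>2"
      by (simp add: algebra_simps diff_divide_distrib add_divide_distrib power3_eq_cube power2_eq_square)
    have "r + (C * (1 + r)\<^sup>2 - r ^ 3) / R\<^sup>2 \<le> R"
    proof (cases "r \<ge> r0")
      case True
      then have r1: "r \<ge> 1" "4 * C \<le> r" using C0 by (simp_all add: r0_def)
      have "C * (1 + r)\<^sup>2 \<le> C * (2 * r)\<^sup>2"
        using r1 C0 by (intro mult_left_mono power_mono) auto
      also have "\<dots> = (4 * C) * r\<^sup>2" by (simp add: power2_eq_square)
      also have "\<dots> \<le> r * r\<^sup>2" using r1 by (intro mult_right_mono) auto
      finally have "C * (1 + r)\<^sup>2 - r ^ 3 \<le> 0" by (simp add: power3_eq_cube power2_eq_square)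
      then have "(C * (1 + r)\<^sup>2 - r ^ 3) / R\<^sup>2 \<le> 0" by (simp add: divide_nonpos_nonneg)
      then show ?thesis using r by simp
    next
      case False
      have R2: "1 \<le> R\<^sup>2" using R by simp
      have "C * (1 + r)\<^sup>2 - r ^ 3 \<le> C * (1 + r0)\<^sup>2"
      proof -
        have "C * (1 + r)\<^sup>2 \<le> C * (1 + r0)\<^sup>2"
          using False r C0 by (intro mult_left_mono power_mono) auto
        moreover have "0 \<le> r ^ 3" using r by simp
        ultimately show ?thesis by linarith
      qed
      then have "(C * (1 + r)\<^sup>2 - r ^ 3) / R\<^sup>2 \<le> C * (1 + r0)\<^sup>2 / R\<^sup>2"
        by (intro divide_right_mono) auto
      also have "\<dots> \<le> C * (1 + r0)\<^sup>2"
        using R2 C0 mult_left_mono[OF R2, of "C * (1 + r0)\<^sup>2"]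
        by (simp add: divide_le_eq)
      finally show ?thesis using False by (simp add: R_def)
    qed
    then show ?thesis using le by simp
  qed
  moreover have "continuous_on (cball 0 R) h"
    unfolding h_def using cont
    by (intro continuous_intros continuous_on_subset[OF cont]) auto
  ultimately obtain z where "h z = z"
    using brouwer[of "cball 0 R" h] R by (auto simp: Pi_def)
  then show ?thesis using R by (auto simp: h_def)
qed

text \<open>The vector \<open>g\<close> is a kernel vector of diag(cnj z, cnj z, z) - K. The
  conjugate of the determinant is z |z|^2 plus terms of order at most two in |z|, so
  \<open>perturbed_cube_zero\<close> gives a z where it vanishes.\<close>

lemma twisted_eigenvector:
  fixes K :: "complex ^ 3 ^ 3"
  shows "\<exists>z g. g \<noteq> 0 \<and> (K *v g) $ 1 = cnj z * g $ 1 \<and> (K *v g) $ 2 = cnj z * g $ 2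
    \<and> (K *v g) $ 3 = z * g $ 3"
proof -
  define G where "G z = (\<chi> i j. (if i = j then (if i = 3 then z else cnj z) else 0) - K $ i $ j)"
    for z
  define k where "k i j = cnj (K $ i $ j)" for i j
  define c1 where "c1 = - k 3 3"
  define c2 where "c2 = - (k 1 1 + k 2 2)"
  define c3 where "c3 = k 1 1 * k 3 3 + k 2 2 * k 3 3 - k 2 3 * k 3 2 - k 1 3 * k 3 1"
  define c4 where "c4 = k 1 1 * k 2 2 - k 1 2 * k 2 1"
  define c5 where "c5 = - k 1 1 * k 2 2 * k 3 3 - k 1 2 * k 2 3 * k 3 1 - k 1 3 * k 2 1 * k 3 2
    + k 1 1 * k 2 3 * k 3 2 + k 1 2 * k 2 1 * k 3 3 + k 1 3 * k 2 2 * k 3 1"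
  define E where "E z = c1 * z * z + c2 * z * cnj z + c3 * z + c4 * cnj z + c5" for z
  have det: "cnj (det (G z)) = z * (z * cnj z) + E z" for z
    unfolding det_3 E_def c1_def c2_def c3_def c4_def c5_def k_def
    by (simp add: G_def) (simp add: algebra_simps)
  define C where "C = cmod c1 + cmod c2 + cmod c3 + cmod c4 + cmod c5"
  have "cmod (E z) \<le> C * (1 + cmod z)\<^sup>2" for z
  proof -
    define r where "r = cmod z"
    have r: "r \<ge> 0" by (simp add: r_def)
    have "cmod (E z) \<le> cmod (c1 * z * z) + cmod (c2 * z * cnj z) + cmod (c3 * z)
        + cmod (c4 * cnj z) + cmod c5"
      unfolding E_def by (intro norm_triangle_le add_mono order_refl)
    also have "\<dots> = cmod c1 * r\<^sup>2 + cmod c2 * r\<^sup>2 + cmod c3 * r + cmod c4 * r + cmod c5 * 1"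
      by (simp add: norm_mult r_def power2_eq_square)
    also have "\<dots> \<le> cmod c1 * (1 + r)\<^sup>2 + cmod c2 * (1 + r)\<^sup>2 + cmod c3 * (1 + r)\<^sup>2
        + cmod c4 * (1 + r)\<^sup>2 + cmod c5 * (1 + r)\<^sup>2"
    proof (intro add_mono mult_left_mono)
      have "(1 + r)\<^sup>2 = 1 + 2 * r + r\<^sup>2" by (simp add: power2_eq_square algebra_simps)
      then show "r \<le> (1 + r)\<^sup>2" "r \<le> (1 + r)\<^sup>2" "1 \<le> (1 + r)\<^sup>2" "r\<^sup>2 \<le> (1 + r)\<^sup>2" "r\<^sup>2 \<le> (1 + r)\<^sup>2"
        using r by simp_all
    qed simp_all
    finally show ?thesis by (simp add: C_def r_def algebra_simps)
  qed
  moreover have "continuous_on UNIV E"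
    unfolding E_def by (intro continuous_intros)
  ultimately obtain z where "z * of_real ((cmod z)\<^sup>2) + E z = 0"
    using perturbed_cube_zero[of E C] by blast
  then have "cnj (det (G z)) = 0" unfolding det complex_norm_square .
  then have "det (G z) = 0" by simp
  then have "\<not> invertible (G z)" by (simp add: invertible_det_nz)
  then obtain g where g: "g \<noteq> 0" "G z *v g = 0"
    unfolding invertible_left_inverse matrix_left_invertible_ker by blast
  have "(G z *v g) $ i = (if i = 3 then z else cnj z) * g $ i - (K *v g) $ i" for i
  proof -
    have "(\<Sum>j\<in>UNIV. (if i = j then c else 0) * g $ j) = c * g $ i" for c
    proof -
      have "(\<Sum>j\<in>UNIV. (if i = j then c else 0) * g $ j) = (\<Sum>j\<in>UNIV. if i = j then c * g $ j else 0)"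
        by (rule sum.cong) auto
      then show ?thesis by simp
    qed
    then show ?thesis
      by (simp only: G_def matrix_vector_mult_def left_diff_distrib sum_subtractf vec_lambda_beta)
  qed
  then have "(if i = 3 then z else cnj z) * g $ i = (K *v g) $ i" for i
    using g(2) by (metis eq_iff_diff_eq_0 zero_index)
  from this[of 1] this[of 2] this[of 3] show ?thesis using g(1) by (intro exI[of _ z] exI[of _ g]) simp
qed

section \<open>Linked vectors\<close>

lemma matrix_sub_rdistrib: "(A - B) ** C = A ** C - B ** C"
  for A :: "complex ^ 'n::finite ^ 'm"
  by (simp add: vec_eq_iff matrix_matrix_mult_def left_diff_distrib sum_subtractf)

lemma four_vectors_dependent:
  fixes v1 v2 v3 v4 :: "complex ^ 'n::finite"
  assumes "CARD('n) \<le> 3"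
  shows "\<exists>a b c d. (a \<noteq> 0 \<or> b \<noteq> 0 \<or> c \<noteq> 0 \<or> d \<noteq> 0) \<and>
    a *s v1 + b *s v2 + c *s v3 + d *s v4 = 0"
proof -
  define M :: "complex ^ 4 ^ 'n" where
    "M = (\<chi> i j. if j = 1 then v1 $ i else if j = 2 then v2 $ i else if j = 3 then v3 $ i else v4 $ i)"
  obtain x where x: "x \<noteq> 0" "M *v x = 0"
    using wide_matrix_kernel[of M] assms by auto
  have "M *v x = x $ 1 *s v1 + x $ 2 *s v2 + x $ 3 *s v3 + x $ 4 *s v4"
    by (simp add: vec_eq_iff M_def matrix_vector_mult_def sum_4 mult.commute)
  moreover have "x $ 1 \<noteq> 0 \<or> x $ 2 \<noteq> 0 \<or> x $ 3 \<noteq> 0 \<or> x $ 4 \<noteq> 0"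
    using x(1) by (auto simp: vec_eq_iff forall_4)
  ultimately show ?thesis using x(2) by metis
qed

lemma projector_mult_vec: "projector p *v x = braket p x *s p"
  by (simp add: projector_eq_outer)

text \<open>The range is the line through \<open>p0\<close>, an eigenvector with eigenvalue t \<ge>
  0. Symmetry fixes the coefficient of Px as (t/r) <p0,x> with r = |p0|^2, so \<open>P\<close> is
  t/r times the projector of \<open>p0\<close>.\<close>

lemma psd_rank_one:
  assumes P: "psd P" and p0: "p0 \<noteq> 0" "p0 = P *v x0" and rank1: "\<And>x. \<exists>c. P *v x = c *s p0"
  shows "\<exists>p. p \<noteq> 0 \<and> P = projector p"
proof -
  define r where "r = (norm p0)\<^sup>2"
  have r: "r > 0" using p0 by (simp add: r_def)
  have br: "braket p0 p0 = of_real r" by (simp add: r_def braket_self)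
  obtain c0 where c0: "P *v p0 = c0 *s p0" using rank1 by blast
  have "braket p0 (P *v p0) = c0 * of_real r" by (simp add: c0 braket_linear br)
  then have "c0 * of_real r = of_real (Re (braket p0 (P *v p0)))"
    using psd_braket_real[OF P, of p0] by metis
  then have "c0 = of_real (Re (braket p0 (P *v p0)) / r)"
    using r by (simp add: field_simps)
  moreover define t where "t = Re (braket p0 (P *v p0)) / r"
  ultimately have t: "c0 = of_real t" "t \<ge> 0"
    using psd_nonneg[OF P] r by simp_all
  define p where "p = of_real (sqrt (t / r)) *s p0"
  have "P *v x = projector p *v x" for x
  proof -
    obtain c where c: "P *v x = c *s p0" using rank1 by blast
    have "c * of_real r = braket (P *v p0) x"
      using c by (simp add: psd_sym[OF P] braket_linear br)
    also have "\<dots> = of_real t * braket p0 x" by (simp add: c0 t braket_linear)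
    finally have "c = of_real (t / r) * braket p0 x" using r by (simp add: field_simps)
    moreover have "of_real (sqrt (t / r)) * of_real (sqrt (t / r)) = (of_real (t / r) :: complex)"
      using r t by (simp flip: of_real_mult)
    ultimately show ?thesis
      by (simp add: c projector_mult_vec p_def braket_linear vector_smult_assoc mult_ac
          flip: mult.assoc)
  qed
  then have "P = projector p" by (simp add: matrix_eq)
  moreover have "p \<noteq> 0"
    using p0 \<open>P = projector p\<close> by (auto simp: projector_mult_vec)
  ultimately show ?thesis by blast
qed

text \<open>The vectors Px1, Px2, Qy0 form a basis. In its coordinates, zf - Bf lies in the range of
  \<open>P\<close> once its third coordinate vanishes, and the adjoint condition holds once the
  first two do. Two rows of \<open>adjm B\<close> and one row of \<open>B\<close> thus form a
  twisted eigenvalue problem.\<close>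

lemma linked_vector_rank_two:
  fixes P Q B :: "complex ^ 'n::finite ^ 'n"
  assumes dim: "CARD('n) \<le> 3"
    and indep: "\<And>a b c. a *s (P *v x1) + b *s (P *v x2) + c *s (Q *v y0) = 0 \<Longrightarrow> a = 0 \<and> b = 0 \<and> c = 0"
  shows "\<exists>z f x y. f \<noteq> 0 \<and> z *s f - B *v f = P *v x \<and> cnj z *s f - adjm B *v f = Q *v y"
proof -
  define p1 p2 q where "p1 = P *v x1" and "p2 = P *v x2" and "q = Q *v y0"
  have indep': "a = 0 \<and> b = 0 \<and> c = 0" if "a *s p1 + b *s p2 + c *s q = 0" for a b c
    using indep[of a b c] that by (simp add: p1_def p2_def q_def)
  have "\<exists>a b c. w = a *s p1 + b *s p2 + c *s q" for w
  proof -
    obtain a b c d where nz: "a \<noteq> 0 \<or> b \<noteq> 0 \<or> c \<noteq> 0 \<or> d \<noteq> 0"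
      and eq: "a *s p1 + b *s p2 + c *s q + d *s w = 0"
      using four_vectors_dependent[OF dim] by metis
    have d: "d \<noteq> 0" using nz eq indep'[of a b c] by auto
    have "w = (-a/d) *s p1 + (-b/d) *s p2 + (-c/d) *s q"
      unfolding vec_eq_iff
    proof
      fix i
      have "a * p1 $ i + b * p2 $ i + c * q $ i + d * w $ i = 0"
        using arg_cong[OF eq, of "\<lambda>v. v $ i"] by simp
      then show "w $ i = ((-a/d) *s p1 + (-b/d) *s p2 + (-c/d) *s q) $ i"
        using d by (simp add: field_simps) (simp add: add_eq_0_iff algebra_simps)
    qed
    then show ?thesis by blast
  qed
  then obtain a b c where coord: "\<And>w. w = a w *s p1 + b w *s p2 + c w *s q" by metis
  define K :: "complex ^ 3 ^ 3" where "K = vector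
    [vector [a (adjm B *v p1), a (adjm B *v p2), a (adjm B *v q)],
     vector [b (adjm B *v p1), b (adjm B *v p2), b (adjm B *v q)],
     vector [c (B *v p1), c (B *v p2), c (B *v q)]]"
  obtain z g where g: "g \<noteq> 0" and K: "(K *v g) $ 1 = cnj z * g $ 1" "(K *v g) $ 2 = cnj z * g $ 2"
    "(K *v g) $ 3 = z * g $ 3"
    using twisted_eigenvector by blast
  define f where "f = g $ 1 *s p1 + g $ 2 *s p2 + g $ 3 *s q"
  have f0: "f \<noteq> 0"
    using g indep'[of "g $ 1" "g $ 2" "g $ 3"] by (auto simp: f_def vec_eq_iff forall_3)
  define \<alpha> where "\<alpha> h A = g $ 1 * h (A *v p1) + g $ 2 * h (A *v p2) + g $ 3 * h (A *v q)"
    for h :: "complex ^ 'n \<Rightarrow> complex" and A :: "complex ^ 'n ^ 'n"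
  have img: "A *v f = \<alpha> a A *s p1 + \<alpha> b A *s p2 + \<alpha> c A *s q" for A
  proof -
    have "A *v f = g $ 1 *s (A *v p1) + g $ 2 *s (A *v p2) + g $ 3 *s (A *v q)"
      by (simp add: f_def vec.add vec.scale)
    also have "\<dots> = g $ 1 *s (a (A *v p1) *s p1 + b (A *v p1) *s p2 + c (A *v p1) *s q)
      + g $ 2 *s (a (A *v p2) *s p1 + b (A *v p2) *s p2 + c (A *v p2) *s q)
      + g $ 3 *s (a (A *v q) *s p1 + b (A *v q) *s p2 + c (A *v q) *s q)"
      by (simp only: coord[symmetric])
    finally show ?thesis by (simp add: \<alpha>_def vec_eq_iff algebra_simps)
  qed
  have k: "\<alpha> a (adjm B) = cnj z * g $ 1" "\<alpha> b (adjm B) = cnj z * g $ 2" "\<alpha> c B = z * g $ 3"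
    using K by (simp_all add: K_def \<alpha>_def matrix_vector_mult_def sum_3 mult.commute)
  have "z *s f - B *v f = (z * g $ 1 - \<alpha> a B) *s p1 + (z * g $ 2 - \<alpha> b B) *s p2"
    unfolding img k by (simp add: f_def vec_eq_iff algebra_simps)
  also have "\<dots> = P *v ((z * g $ 1 - \<alpha> a B) *s x1 + (z * g $ 2 - \<alpha> b B) *s x2)"
    by (simp only: vec.add vec.scale p1_def p2_def)
  finally have 1: "z *s f - B *v f = \<dots>" .
  have "cnj z *s f - adjm B *v f = (cnj z * g $ 3 - \<alpha> c (adjm B)) *s q"
    unfolding img k by (simp add: f_def vec_eq_iff algebra_simps)
  also have "\<dots> = Q *v ((cnj z * g $ 3 - \<alpha> c (adjm B)) *s y0)"
    by (simp only: vec.scale q_def)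
  finally show ?thesis using 1 f0 by blast
qed

lemma sum_UNIV_option:
  fixes f :: "'n::finite option \<Rightarrow> 'b::comm_monoid_add"
  shows "(\<Sum>k\<in>UNIV. f k) = f None + (\<Sum>i\<in>UNIV. f (Some i))"
  by (simp add: UNIV_option_conv sum.reindex o_def)

text \<open>The matrix \<open>[[B, p], [q*, s]]\<close> is normal, and \<open>f\<close> consists of the leading components of one of
  its eigenvectors.\<close>

lemma linked_vector_of_normal_dilation:
  fixes B :: "complex ^ 'n::finite ^ 'n"
  assumes comm: "outer p p - outer q q = adjm B ** B - B ** adjm B" and p0: "p \<noteq> 0"
    and s: "adjm B *v p - B *v q = cnj s *s p - s *s q"
  shows "\<exists>z f y. f \<noteq> 0 \<and> z *s f - B *v f = y *s p \<and> cnj z *s f - adjm B *v f = y *s q"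
proof -
  define N :: "complex ^ 'n option ^ 'n option" where
    "N = (\<chi> k l. case (k, l) of (Some i, Some j) \<Rightarrow> B $ i $ j | (Some i, None) \<Rightarrow> p $ i
       | (None, Some j) \<Rightarrow> cnj (q $ j) | (None, None) \<Rightarrow> s)"
  have NF: "(N *v F) $ Some i = (B *v (\<chi> i. F $ Some i)) $ i + F $ None * p $ i"
    "(adjm N *v F) $ Some i = (adjm B *v (\<chi> i. F $ Some i)) $ i + F $ None * q $ i" for F i
    by (simp_all add: N_def matrix_vector_mult_def sum_UNIV_option add.commute mult.commute)
  have tr: "braket p p = braket q q"
  proof -
    have "trace (outer p p - outer q q) = trace (adjm B ** B) - trace (B ** adjm B)"
      by (simp add: comm trace_sub)
    then show ?thesis by (simp add: trace_mul_sym[of "adjm B"] trace_sub trace_outer)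
  qed
  have SS: "p $ i * cnj (p $ j) - q $ i * cnj (q $ j)
      = (\<Sum>k\<in>UNIV. cnj (B $ k $ i) * B $ k $ j) - (\<Sum>k\<in>UNIV. B $ i $ k * cnj (B $ j $ k))" for i j
    using arg_cong[OF comm, of "\<lambda>M. M $ i $ j"] by (simp add: outer_def matrix_matrix_mult_def)
  have SN: "(\<Sum>k\<in>UNIV. cnj (B $ k $ i) * p $ k) - (\<Sum>k\<in>UNIV. B $ i $ k * q $ k)
      = cnj s * p $ i - s * q $ i" for i
    using arg_cong[OF s, of "\<lambda>v. v $ i"] by (simp add: matrix_vector_mult_def)
  have NS: "(\<Sum>k\<in>UNIV. B $ k $ i * cnj (p $ k)) - (\<Sum>k\<in>UNIV. cnj (B $ i $ k) * cnj (q $ k))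
      = s * cnj (p $ i) - cnj s * cnj (q $ i)" for i
    using arg_cong[OF SN[of i], of cnj] by simp
  have "(adjm N ** N) $ k $ l = (N ** adjm N) $ k $ l" for k l
  proof (cases k; cases l)
    assume "k = None" "l = None"
    then show ?thesis
      using tr by (simp add: matrix_matrix_mult_def sum_UNIV_option N_def braket_def mult.commute)
  next
    fix j assume "k = None" "l = Some j"
    then show ?thesis
      using NS[of j] by (simp add: matrix_matrix_mult_def sum_UNIV_option N_def algebra_simps)
  next
    fix i assume "k = Some i" "l = None"
    then show ?thesis
      using SN[of i] by (simp add: matrix_matrix_mult_def sum_UNIV_option N_def algebra_simps)
  next
    fix i j assume "k = Some i" "l = Some j"
    then show ?thesis
      using SS[of i j] by (simp add: matrix_matrix_mult_def sum_UNIV_option N_def algebra_simps)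
  qed
  then have normal: "adjm N ** N = N ** adjm N" by (simp add: vec_eq_iff)
  obtain z F where F: "F \<noteq> 0" "N *v F = z *s F" using eigenvector_exists by blast
  define f where "f = (\<chi> i. F $ Some i)"
  have 1: "z *s f - B *v f = F $ None *s p"
    using NF(1)[of F] by (simp add: F(2) f_def vec_eq_iff algebra_simps)
  have 2: "cnj z *s f - adjm B *v f = F $ None *s q"
    using NF(2)[of F] by (simp add: normal_eigenvector[OF normal F(2)] f_def vec_eq_iff algebra_simps)
  \<comment> \<open>If the leading components vanished, p \<noteq> 0 would force the last component
    to vanish as well.\<close>
  have "f \<noteq> 0"
  proof
    assume f: "f = 0"
    then have "F $ None *s p = 0" using 1 by simp
    then have "F $ None = 0" using p0 by (simp add: vec.scale_eq_0_iff)
    moreover have "F $ Some i = 0" for i using arg_cong[OF f, of "\<lambda>v. v $ i"] by (simp add: f_def)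
    ultimately have "F $ k = 0" for k by (cases k) auto
    then show False using F(1) by (simp add: vec_eq_iff)
  qed
  then show ?thesis using 1 2 by blast
qed

text \<open>\<open>L\<close> is the Gram determinant of \<open>p\<close> and \<open>q\<close>, and the left-hand side is \<open>L\<close> times the orthogonal
  projection of \<open>x\<close> onto their complement.\<close>

lemma complement_rank_one:
  fixes p q :: "complex ^ 'n::finite"
  assumes dim: "CARD('n) \<le> 3"
    and indep: "\<And>a b. a *s p + b *s q = 0 \<Longrightarrow> a = 0 \<and> b = 0"
    and a: "braket p p = a" "braket q q = a" and g: "braket p q = g"
    and L: "L = a * a - g * cnj g" "L \<noteq> 0"
  shows "\<exists>k n. k \<noteq> 0 \<and> (\<forall>x. L *s x - ((a * braket p x - g * braket q x) *s p
    + (a * braket q x - cnj g * braket p x) *s q) = (k * braket n x) *s n)"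
proof -
  define R where "R x = L *s x - ((a * braket p x - g * braket q x) *s p
    + (a * braket q x - cnj g * braket p x) *s q)" for x
  have g': "braket q p = cnj g" using g by (metis cnj_braket)
  have ra: "cnj a = a" using a by (metis cnj_braket)
  have rL: "cnj L = L" by (simp add: L ra mult.commute)
  have pR: "braket p (R x) = 0" and qR: "braket q (R x) = 0" for x
    by (simp_all add: R_def braket_linear a g g' L algebra_simps)
  have symR: "braket x (R y) = braket (R x) y" for x y
    by (simp add: R_def braket_linear ra rL algebra_simps)
  have RR: "R (R x) = L *s R x" for x
    by (simp add: R_def[of "R x"] pR qR)
  show ?thesis
  proof (cases "\<forall>x. R x = 0")
    case True
    \<comment> \<open>Here \<open>p\<close> and \<open>q\<close> span the whole space, and n = 0
      serves.\<close>
    then show ?thesis unfolding R_def by (intro exI[of _ 1] exI[of _ 0]) simp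
  next
    case False
    then obtain x0 where x0: "R x0 \<noteq> 0" by blast
    define n where "n = R x0"
    define k where "k = L / braket n n"
    have Rn: "R n = L *s n" by (simp add: n_def RR)
    have n0: "braket n n \<noteq> 0" using x0 by (simp add: n_def)
    have "R y = (k * braket n y) *s n" for y
    proof -
      obtain b1 b2 c d where nz: "b1 \<noteq> 0 \<or> b2 \<noteq> 0 \<or> c \<noteq> 0 \<or> d \<noteq> 0"
        and eq: "b1 *s p + b2 *s q + c *s n + d *s R y = 0"
        using four_vectors_dependent[OF dim] by metis
      \<comment> \<open>The vector \<open>u\<close> lies in the span of \<open>p\<close> and
        \<open>q\<close> and, by the relation, also in its orthogonal complement. So it is zero, and
        the relation makes \<open>R y\<close> a multiple of \<open>n\<close>.\<close>
      define u where "u = b1 *s p + b2 *s q"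
      have "braket u (c *s n + d *s R y) = 0"
        by (simp add: u_def n_def braket_linear pR qR)
      moreover have u: "u = - (c *s n + d *s R y)"
        using eq unfolding u_def by (simp add: add_eq_0_iff2 add.assoc)
      ultimately have "braket u u = 0"
        using braket_diff_right[of u 0 "c *s n + d *s R y"] by simp
      then have "u = 0" by simp
      then have b: "b1 = 0" "b2 = 0" using indep unfolding u_def by blast+
      then have eq': "c *s n + d *s R y = 0" using eq by simp
      have d: "d \<noteq> 0"
        using nz b eq' n0 by (auto simp: vec.scale_eq_0_iff)
      define e where "e = - c / d"
      have Ry: "R y = e *s n"
        unfolding vec_eq_iff
      proof
        fix i
        have "c * n $ i + d * R y $ i = 0" using arg_cong[OF eq', of "\<lambda>v. v $ i"] by simp
        then show "R y $ i = (e *s n) $ i"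
          using d by (simp add: e_def field_simps) (simp add: add_eq_0_iff algebra_simps)
      qed
      have "e * braket n n = braket (R n) y"
        by (simp add: braket_linear flip: symR) (simp add: Ry braket_linear)
      also have "\<dots> = L * braket n y" by (simp add: Rn braket_linear rL)
      finally have "e = k * braket n y" using n0 by (simp add: k_def field_simps)
      then show ?thesis by (simp add: Ry)
    qed
    moreover have "k \<noteq> 0" using L n0 by (simp add: k_def)
    ultimately show ?thesis unfolding R_def by blast
  qed
qed

text \<open>The dilation needs \<open>B* p\<close> and \<open>B q\<close> to have components of equal modulus outside the span of
  \<open>p\<close> and \<open>q\<close>, up to a phase \<open>\<omega>\<close> that can be absorbed into \<open>q\<close>.  This is forced by the traces of the
  commutator against \<open>B\<close>, \<open>B B*\<close> and \<open>B* B\<close>.\<close>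

lemma linked_vector_rank_one:
  fixes B :: "complex ^ 'n::finite ^ 'n"
  assumes dim: "CARD('n) \<le> 3"
    and comm: "outer p p - outer q q = adjm B ** B - B ** adjm B"
    and indep: "\<And>a b. a *s p + b *s q = 0 \<Longrightarrow> a = 0 \<and> b = 0"
  shows "\<exists>z f y y'. f \<noteq> 0 \<and> z *s f - B *v f = y *s p \<and> cnj z *s f - adjm B *v f = y' *s q"
proof -
  define D where "D = outer p p - outer q q"
  define \<tau> where "\<tau> M = braket p (M *v p) - braket q (M *v q)" for M :: "complex ^ 'n ^ 'n"
  have \<tau>: "\<tau> M = trace (D ** M)" for M
    by (simp add: \<tau>_def D_def matrix_sub_rdistrib trace_sub outer_mult trace_outer braket_adjm')
  have D_alt: "D = adjm B ** B - B ** adjm B" by (simp add: D_def comm)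
  have D_vec: "D *v x = braket p x *s p - braket q x *s q" for x
    by (simp add: D_def matrix_vector_mult_diff_rdistrib)
  define a g where "a = braket p p" and "g = braket p q"
  have g': "braket q p = cnj g" by (simp add: g_def)
  have "trace D = 0"
    unfolding D_alt trace_sub by (simp add: trace_mul_sym[of "adjm B"])
  then have a': "braket q q = a" by (simp add: D_def trace_sub trace_outer a_def)
  have ra: "cnj a = a" by (simp add: a_def)
  define L where "L = a * a - g * cnj g"
  have rL: "cnj L = L" by (simp add: L_def ra mult.commute)
  have p0: "p \<noteq> 0" using indep[of 1 0] by auto
  then have a0: "a \<noteq> 0" by (simp add: a_def)
  have L0: "L \<noteq> 0"
  proof
    assume "L = 0"
    \<comment> \<open>This combination has squared norm a L, so L = 0 would contradict
      independence.\<close>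
    define w where "w = (- g) *s p + a *s q"
    have "braket w w = a * L"
      by (simp add: w_def braket_linear ra g' L_def a' algebra_simps flip: a_def g_def)
    then have "w = 0" by (simp add: \<open>L = 0\<close>)
    then show False using indep a0 unfolding w_def by blast
  qed
  obtain k n where k0: "k \<noteq> 0" and kn: "\<And>x. L *s x - ((a * braket p x - g * braket q x) *s p
    + (a * braket q x - cnj g * braket p x) *s q) = (k * braket n x) *s n"
    using complement_rank_one[OF dim indep a_def[symmetric] a' g_def[symmetric] L_def L0] by blast
  define \<beta> \<kappa> where "\<beta> = braket p (B *v p)" and "\<kappa> = braket p (B *v q)"
  \<comment> \<open>By cyclicity, the trace of the commutator of \<open>adjm B\<close> and
    \<open>B\<close> against \<open>B\<close> vanishes.\<close>
  have "\<tau> B = 0"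
    unfolding \<tau> D_alt matrix_sub_rdistrib trace_sub
    using trace_mul_sym[of "adjm B" "B ** B"] trace_mul_sym[of "B ** adjm B" B]
    by (simp add: matrix_mul_assoc)
  then have \<beta>': "braket q (B *v q) = \<beta>" by (simp add: \<tau>_def \<beta>_def)
  \<comment> \<open>For S = \<open>adjm B ** B\<close> and T = \<open>B ** adjm B\<close>, the trace
    of (S - T)(S + T) is tr S^2 - tr T^2, which is zero by cyclicity.\<close>
  have "\<tau> (adjm B ** B + B ** adjm B) = 0"
    unfolding \<tau> D_alt matrix_sub_rdistrib matrix_add_ldistrib trace_sub trace_add
    using trace_mul_sym[of "adjm B ** B" "B ** adjm B"]
      trace_mul_sym[of "adjm B" "B ** adjm B ** B"]
    by (simp add: matrix_mul_assoc)
  then have t1: "\<tau> (adjm B ** B) + \<tau> (B ** adjm B) = 0"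
    by (simp add: \<tau>_def matrix_vector_mult_add_rdistrib braket_linear algebra_simps)
  \<comment> \<open>The difference is tr D^2 = 2L; with the vanishing sum it fixes both
    values.\<close>
  have "\<tau> (adjm B ** B) - \<tau> (B ** adjm B) = \<tau> D"
    by (simp add: \<tau>_def D_alt matrix_vector_mult_diff_rdistrib braket_linear)
  also have "\<dots> = 2 * L"
    by (simp add: \<tau>_def D_vec braket_linear g' L_def a' flip: a_def g_def)
  finally have t2: "\<tau> (B ** adjm B) = - L" using t1 by (simp add: algebra_simps add_eq_0_iff)
  have "braket q ((adjm B ** B) *v q) - braket q ((B ** adjm B) *v q) = braket q (D *v q)"
    by (simp add: D_alt matrix_vector_mult_diff_rdistrib braket_linear)
  also have "\<dots> = - L"
    by (simp add: D_vec braket_linear g' L_def a' flip: a_def g_def)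
  finally have "L + braket p ((B ** adjm B) *v p) = L + braket q ((adjm B ** B) *v q)"
    using t2 by (simp add: \<tau>_def algebra_simps)
  then have "braket p ((B ** adjm B) *v p) = braket q ((adjm B ** B) *v q)" by simp
  define x y where "x = adjm B *v p" and "y = B *v q"
  have xx: "braket x x = braket y y"
    using \<open>braket p ((B ** adjm B) *v p) = braket q ((adjm B ** B) *v q)\<close>
    by (simp add: x_def y_def braket_adjm' flip: matrix_vector_mul_assoc)
  have px: "braket p x = cnj \<beta>" "braket q x = cnj \<kappa>" "braket p y = \<kappa>" "braket q y = \<beta>"
    by (simp_all add: x_def y_def \<beta>' braket_adjm[of _ "adjm B"]) (simp_all add: \<beta>_def \<kappa>_def)
  have xp: "braket x p = \<beta>" "braket x q = \<kappa>" "braket y p = cnj \<kappa>" "braket y q = cnj \<beta>"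
    using px by (metis cnj_braket complex_cnj_cnj)+
  define A1 A2 where "A1 = braket n x" and "A2 = braket n y"
  \<comment> \<open>The vectors \<open>x\<close> and \<open>y\<close> have equal norms and equally
    long components in the span of \<open>p\<close> and \<open>q\<close>, so their overlaps with
    \<open>n\<close> agree in modulus.\<close>
  have "k * (A1 * cnj A1) = k * (A2 * cnj A2)"
    using arg_cong[OF kn[of x], of "braket x"] arg_cong[OF kn[of y], of "braket y"]
    by (simp add: braket_linear px xp xx A1_def A2_def algebra_simps)
  then have "A1 * cnj A1 = A2 * cnj A2" using k0 by simp
  then have mod: "cmod A1 = cmod A2"
    by (metis complex_mod_sqrt_Re_mult_cnj)
  obtain \<omega> where \<omega>: "cmod \<omega> = 1" "A1 = \<omega> * A2"
  proof (cases "A2 = 0")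
    case True
    then show ?thesis using that[of 1] mod by simp
  next
    case False
    then show ?thesis using that[of "A1 / A2"] mod by (simp add: norm_divide)
  qed
  have \<omega>\<omega>: "\<omega> * cnj \<omega> = 1" using \<omega>(1) by (simp flip: complex_norm_square)
  have \<omega>\<omega>': "\<omega> * (cnj \<omega> * u) = u" "cnj \<omega> * (\<omega> * u) = u" "\<omega> * (w * (cnj \<omega> * u)) = w * u" for u w
  proof -
    have "\<omega> * (cnj \<omega> * u) = (\<omega> * cnj \<omega>) * u" "cnj \<omega> * (\<omega> * u) = (\<omega> * cnj \<omega>) * u"
      "\<omega> * (w * (cnj \<omega> * u)) = (\<omega> * cnj \<omega>) * (w * u)"
      by (simp_all only: mult_ac)
    then show "\<omega> * (cnj \<omega> * u) = u" "cnj \<omega> * (\<omega> * u) = u" "\<omega> * (w * (cnj \<omega> * u)) = w * u"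
      by (simp_all add: \<omega>\<omega>)
  qed
  define m where "m = cnj \<beta> - \<omega> * \<kappa>"
  define v where "v = x - \<omega> *s y"
  have v: "braket p v = m" "braket q v = - \<omega> * cnj m" "braket n v = 0"
    using \<omega>(2) by (simp_all add: v_def braket_linear px m_def algebra_simps \<omega>\<omega> \<omega>\<omega>' A1_def A2_def)
  \<comment> \<open>Since \<open>v\<close> is orthogonal to \<open>n\<close>, it lies in the span of
    \<open>p\<close> and \<open>q\<close>. Cramer's rule for the Gram matrix gives its coordinates;
    they are tied by conjugation, as the corner entry of the dilation requires.\<close>
  define s where "s = (a * cnj m + cnj g * cnj \<omega> * m) / L"
  have Lv: "L *s v = (L * cnj s) *s p - (L * (\<omega> * s)) *s q"
  proof -
    have "L * cnj s = a * m + g * \<omega> * cnj m" "L * s = a * cnj m + cnj g * cnj \<omega> * m"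
      using L0 by (simp_all add: s_def ra rL)
    then have eqs: "L * cnj s = a * m + g * (\<omega> * cnj m)" "L * (\<omega> * s) = \<omega> * (a * cnj m + cnj g * cnj \<omega> * m)"
      by (simp_all add: mult_ac)
    show ?thesis
      using kn[of v] unfolding eqs v(3)
      by (simp add: v vec_eq_iff algebra_simps \<omega>\<omega>')
  qed
  have "v = cnj s *s p - s *s (\<omega> *s q)"
  proof -
    have "L *s v = L *s (cnj s *s p - s *s (\<omega> *s q))"
      by (simp add: Lv vec_eq_iff algebra_simps)
    then show ?thesis using L0 by (metis vec.scale_left_imp_eq)
  qed
  then have sv: "adjm B *v p - B *v (\<omega> *s q) = cnj s *s p - s *s (\<omega> *s q)"
    by (simp add: v_def x_def y_def vec.scale)
  have "outer (\<omega> *s q) (\<omega> *s q) = outer q q"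
    using \<omega>\<omega> by (simp add: vec_eq_iff outer_def mult_ac \<omega>\<omega>')
  then obtain z f t where "f \<noteq> 0" "z *s f - B *v f = t *s p" "cnj z *s f - adjm B *v f = t *s (\<omega> *s q)"
    using linked_vector_of_normal_dilation[of p "\<omega> *s q" B s] comm p0 sv by auto
  then show ?thesis by (metis vector_smult_assoc)
qed

text \<open>The traces of \<open>P\<close> and \<open>Q\<close> agree, so both vanish or neither
  does. If they do not and the ranges meet only in zero, either one range contains two independent
  vectors, which stay independent with one from the other range, or both are lines.\<close>

lemma linked_vector:
  fixes P Q B :: "complex ^ 'n::finite ^ 'n"
  assumes dim: "CARD('n) \<le> 3" and P: "psd P" and Q: "psd Q"
    and comm: "P - Q = adjm B ** B - B ** adjm B"
  shows "(\<exists>x y. P *v x = Q *v y \<and> P *v x \<noteq> 0) \<or>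
    (\<exists>z f x y. f \<noteq> 0 \<and> z *s f - B *v f = P *v x \<and> cnj z *s f - adjm B *v f = Q *v y)"
proof -
  have tr: "trace P = trace Q"
    using arg_cong[OF comm, of trace] by (simp add: trace_sub trace_mul_sym[of "adjm B"])
  show ?thesis
  proof (cases "P = 0 \<or> Q = 0")
    case True
    then have PQ: "P = 0" "Q = 0"
      using tr psd_trace_eq_0[OF P] psd_trace_eq_0[OF Q] by (auto simp: trace_def simp flip: Re_sum)
    then have normal: "adjm B ** B = B ** adjm B" using comm by simp
    obtain z f where f: "f \<noteq> 0" "B *v f = z *s f" using eigenvector_exists by blast
    show ?thesis
      by (intro disjI2 exI[of _ z] exI[of _ f]) (simp add: f normal_eigenvector[OF normal f(2)] PQ)
  next
    case False
    then obtain x0 y0 where x0: "P *v x0 \<noteq> 0" and y0: "Q *v y0 \<noteq> 0"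
      by (metis matrix_eq matrix_vector_mult_0)
    show ?thesis
    proof (subst disj_imp, rule impI)
      assume "\<not> (\<exists>x y. P *v x = Q *v y \<and> P *v x \<noteq> 0)"
      then have disj: "P *v x = 0" if "P *v x = Q *v y" for x y using that by blast
      have indep3: "a = 0 \<and> b = 0 \<and> c = 0"
        if M: "psd M" and
          ne: "M *v u1 \<noteq> 0" "\<And>c. M *v u2 \<noteq> c *s (M *v u1)" "M' *v w \<noteq> 0"
          and disj: "\<And>x y. M *v x = M' *v y \<Longrightarrow> M *v x = 0"
          and eq: "a *s (M *v u1) + b *s (M *v u2) + c *s (M' *v w) = 0"
        for M M' :: "complex ^ 'n ^ 'n" and u1 u2 w a b c
      proof -
        have "M *v (a *s u1 + b *s u2) = M' *v ((- c) *s w)"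
          using eq by (simp only: vec.add vec.scale) (simp add: add_eq_0_iff2)
        then have 0: "a *s (M *v u1) + b *s (M *v u2) = 0"
          using disj by (metis vec.add vec.scale)
        then have c: "c = 0" using eq ne(3) by (simp add: vec.scale_eq_0_iff)
        have b: "b = 0"
        proof (rule ccontr)
          assume b: "b \<noteq> 0"
          have "M *v u2 = (- a / b) *s (M *v u1)"
            unfolding vec_eq_iff
          proof
            fix i
            have "a * (M *v u1) $ i + b * (M *v u2) $ i = 0"
              using arg_cong[OF 0, of "\<lambda>v. v $ i"] by simp
            then show "(M *v u2) $ i = ((- a / b) *s (M *v u1)) $ i"
              using b by (simp add: field_simps) (simp add: add_eq_0_iff algebra_simps)
          qed
          then show False using ne(2) by blast
        qed
        then have "a = 0" using 0 ne(1) by (simp add: vec.scale_eq_0_iff)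
        then show ?thesis using b c by simp
      qed
      show "\<exists>z f x y. f \<noteq> 0 \<and> z *s f - B *v f = P *v x \<and> cnj z *s f - adjm B *v f = Q *v y"
      proof (cases "\<exists>x1. \<forall>c. P *v x1 \<noteq> c *s (P *v x0)")
        case True
        then obtain x1 where x1: "\<And>c. P *v x1 \<noteq> c *s (P *v x0)" by blast
        show ?thesis
        proof (rule linked_vector_rank_two[OF dim])
          show "a = 0 \<and> b = 0 \<and> c = 0"
            if "a *s (P *v x0) + b *s (P *v x1) + c *s (Q *v y0) = 0" for a b c
            by (rule indep3[of P x0 x1 Q y0]) (use P x0 x1 y0 disj that in blast)+
        qed
      next
        case rP: False
        show ?thesis
        proof (cases "\<exists>y1. \<forall>c. Q *v y1 \<noteq> c *s (Q *v y0)")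
          case True
          then obtain y1 where y1: "\<And>c. Q *v y1 \<noteq> c *s (Q *v y0)" by blast
          have "Q *v x = 0" if "Q *v x = P *v y" for x y using disj[of y x] that by simp
          \<comment> \<open>Exchanging \<open>P\<close> and \<open>Q\<close> replaces
            \<open>B\<close> by its adjoint and z by its conjugate.\<close>
          then have "\<exists>z f x y. f \<noteq> 0 \<and> z *s f - adjm B *v f = Q *v x
              \<and> cnj z *s f - adjm (adjm B) *v f = P *v y"
          proof (intro linked_vector_rank_two[OF dim])
            show "a = 0 \<and> b = 0 \<and> c = 0"
              if "a *s (Q *v y0) + b *s (Q *v y1) + c *s (P *v x0) = 0" for a b c
              by (rule indep3[of Q y0 y1 P x0])
                (use Q x0 y1 y0 \<open>\<And>x y. Q *v x = P *v y \<Longrightarrow> Q *v x = 0\<close> that in blast)+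
          qed
          then show ?thesis by (metis adjm_adjm complex_cnj_cnj)
        next
          case False
          obtain p where p: "p \<noteq> 0" "P = projector p"
            using psd_rank_one[OF P x0 refl] rP by blast
          obtain q where q: "q \<noteq> 0" "Q = projector q"
            using psd_rank_one[OF Q y0 refl] False by blast
          have hitp: "P *v ((c / braket p p) *s p) = c *s p" for c
            using p by (simp add: projector_mult_vec braket_linear)
          have hitq: "Q *v ((c / braket q q) *s q) = c *s q" for c
            using q by (simp add: projector_mult_vec braket_linear)
          have "a = 0 \<and> b = 0" if "a *s p + b *s q = 0" for a b
          proof -
            have "a *s p = (- b) *s q" using that by (simp add: add_eq_0_iff2)
            then have "a *s p = 0" using disj by (metis hitp hitq)
            then show ?thesis using p q that by (auto simp: vec.scale_eq_0_iff)
          qed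
          moreover have "outer p p - outer q q = adjm B ** B - B ** adjm B"
            using comm p q by (simp add: projector_eq_outer)
          ultimately obtain z f t t' where "f \<noteq> 0" "z *s f - B *v f = t *s p"
            "cnj z *s f - adjm B *v f = t' *s q"
            using linked_vector_rank_one[OF dim] by blast
          then show ?thesis by (metis hitp hitq)
        qed
      qed
    qed
  qed
qed

section \<open>Product vectors in the ranges of block matrices\<close>

lemma braket_matrix: "braket (M *v u) (N *v v) = braket u ((adjm M ** N) *v v)"
  by (simp add: braket_adjm' flip: matrix_vector_mul_assoc)

text \<open>Positivity of the block matrix \<open>[[A, B], [B*, C]]\<close>.\<close>

definition block_psd :: "'n::finite cmat \<Rightarrow> 'n cmat \<Rightarrow> 'n cmat \<Rightarrow> bool" where
  "block_psd A B C \<longleftrightarrow> adjm A = A \<and> adjm C = C \<and>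
    (\<forall>x y. 0 \<le> Re (braket x (A *v x) + 2 * braket x (B *v y) + braket y (C *v y)))"

lemma block_psd_snd: "block_psd A B C \<Longrightarrow> psd C"
  unfolding block_psd_def by (intro psdI) (auto dest: spec[of _ 0])

text \<open>If g = Bf were nonzero, the form at x = -s g, y = f would be s^2 <g,Ag> - 2 s |g|^2,
  which is negative for small positive s.\<close>

lemma block_psd_kernel:
  assumes psd: "block_psd A B C" and f: "C *v f = 0"
  shows "B *v f = 0"
proof (rule ccontr)
  assume "B *v f \<noteq> 0"
  define g a b where "g = B *v f" and "a = Re (braket g (A *v g))" and "b = (norm g)\<^sup>2"
  have b: "b > 0" using \<open>B *v f \<noteq> 0\<close> by (simp add: b_def g_def)
  have "0 \<le> Re (braket g (A *v g) + 2 * braket g (B *v 0) + braket 0 (C *v 0))"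
    using psd unfolding block_psd_def by blast
  then have a: "a \<ge> 0" by (simp add: a_def)
  define s where "s = b / (a + 1)"
  have s: "s > 0" using a b by (simp add: s_def)
  define x where "x = of_real (- s) *s g"
  have "0 \<le> Re (braket x (A *v x) + 2 * braket x (B *v f) + braket f (C *v f))"
    using psd unfolding block_psd_def by blast
  also have "\<dots> = s * s * a - 2 * s * b"
    by (simp only: x_def f vec.scale braket_linear braket_self a_def b_def flip: g_def)
      (simp add: algebra_simps)
  finally have "2 * b \<le> s * a" using s by (simp add: algebra_simps)
  moreover have "s * a \<le> b" using a b by (simp add: s_def field_simps)
  ultimately show False using b by simp
qed

text \<open>For fixed \<open>x\<close> the form is smallest at the negative of
  \<open>adjm B *v x\<close>, where its value is the form of the Schur complement.\<close>

lemma schur_complement: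
  assumes "adjm A = A"
    and pos: "\<And>x y. 0 \<le> Re (braket x (A *v x) + 2 * braket x (B *v y) + braket y y)"
  shows "psd (A - B ** adjm B)"
proof (rule psdI)
  show "adjm (A - B ** adjm B) = A - B ** adjm B"
    by (simp add: adjm_diff adjm_mult assms(1))
  fix x
  define y where "y = adjm B *v x"
  have "0 \<le> Re (braket x (A *v x) + 2 * braket x (B *v (- 1 *s y)) + braket (- 1 *s y) (- 1 *s y))"
    by (rule pos)
  also have "\<dots> = Re (braket x (A *v x) - braket y y)"
    by (simp only: vec.scale braket_linear braket_adjm[of x B] flip: y_def) simp
  also have "braket y y = braket x ((B ** adjm B) *v x)"
    by (simp add: y_def braket_adjm' flip: matrix_vector_mul_assoc)
  finally show "0 \<le> Re (braket x ((A - B ** adjm B) *v x))"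
    by (simp add: matrix_vector_mult_diff_rdistrib braket_linear)
qed

text \<open>The range of [[A, B], [adjm B, C]] contains (a f, b f), and that of its partial
  transpose [[A, adjm B], [B, C]] contains (cnj a f, cnj b f): product vectors whose qubit factors
  are (a, b) and its conjugate.\<close>

definition product_vector_in_blocks :: "'n::finite cmat \<Rightarrow> 'n cmat \<Rightarrow> 'n cmat \<Rightarrow> bool" where
  "product_vector_in_blocks A B C \<longleftrightarrow> (\<exists>a b f x y x' y'. f \<noteq> 0 \<and> (a \<noteq> 0 \<or> b \<noteq> 0) \<and>
    A *v x + B *v y = a *s f \<and> adjm B *v x + C *v y = b *s f \<and>
    A *v x' + adjm B *v y' = cnj a *s f \<and> B *v x' + C *v y' = cnj b *s f)"

lemma product_vector_in_blocks_unit: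
  fixes A B :: "'n::finite cmat"
  assumes "CARD('n) \<le> 3" "psd (A - B ** adjm B)" "psd (A - adjm B ** B)"
  shows "product_vector_in_blocks A B (mat 1)"
proof -
  define P Q where "P = A - B ** adjm B" and "Q = A - adjm B ** B"
  have P: "A *v x = P *v x + B *v (adjm B *v x)" and Q: "A *v x = Q *v x + adjm B *v (B *v x)" for x
    by (simp_all add: P_def Q_def matrix_vector_mult_diff_rdistrib matrix_vector_mul_assoc)
  have "P - Q = adjm B ** B - B ** adjm B" by (simp add: P_def Q_def)
  then consider x y where "P *v x = Q *v y" "P *v x \<noteq> 0"
    | z f x y where "f \<noteq> 0" "z *s f - B *v f = P *v x" "cnj z *s f - adjm B *v f = Q *v y"
    using linked_vector[of P Q B] assms unfolding P_def Q_def by blast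
  then show ?thesis
  proof cases
    case 1
    \<comment> \<open>A common vector of the ranges of \<open>P\<close> and \<open>Q\<close> gives
      (a, b) = (1, 0).\<close>
    have "A *v x + B *v (- (adjm B *v x)) = P *v x"
      using vec.neg[of B "adjm B *v x"] by (simp add: P)
    moreover have "A *v y + adjm B *v (- (B *v y)) = P *v x"
      using vec.neg[of "adjm B" "B *v y"] 1 by (simp add: Q)
    moreover have "adjm B *v x + mat 1 *v (- (adjm B *v x)) = 0 *s (P *v x)"
      "B *v y + mat 1 *v (- (B *v y)) = cnj 0 *s (P *v x)" "1 *s (P *v x) = P *v x"
      "cnj 1 *s (P *v x) = P *v x"
      by simp_all
    ultimately show ?thesis
      unfolding product_vector_in_blocks_def using 1(2) zero_neq_one by metis
  next
    case 2
    \<comment> \<open>A linked vector \<open>f\<close> gives (a, b) = (z, 1).\<close>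
    have "A *v x + B *v (f - adjm B *v x) = z *s f"
      using 2 by (simp add: P vec.diff algebra_simps)
    moreover have "A *v y + adjm B *v (f - B *v y) = cnj z *s f"
      using 2 by (simp add: Q vec.diff algebra_simps)
    moreover have "adjm B *v x + mat 1 *v (f - adjm B *v x) = 1 *s f"
      "B *v y + mat 1 *v (f - B *v y) = cnj 1 *s f"
      by simp_all
    ultimately show ?thesis
      unfolding product_vector_in_blocks_def using 2(1) zero_neq_one by metis
  qed
qed

text \<open>The columns of \<open>W\<close> span a complement of the kernel of \<open>C\<close>, and
  compression by \<open>W\<close> turns \<open>C\<close> into the identity. The kernel of
  \<open>C\<close> lies in those of \<open>A\<close>, \<open>B\<close> and \<open>adjm B\<close>, so
  each block is recovered from its compression by T = C W, and solutions lift along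
  \<open>T\<close>.\<close>

lemma product_vector_in_blocks_compressed:
  fixes W :: "complex ^ 'r::finite ^ 'n::finite"
  assumes dim: "CARD('r) \<le> 3"
    and psd: "block_psd A B C" "block_psd A (adjm B) C"
    and kernel: "\<And>x. C *v x = 0 \<Longrightarrow> A *v x = 0"
    and orth: "adjm W ** C ** W = mat 1" and complete: "C ** W ** adjm W ** C = C"
  shows "product_vector_in_blocks A B C"
proof -
  define T where "T = C ** W"
  have herm: "adjm A = A" "adjm C = C" using psd by (auto simp: block_psd_def)
  have T: "adjm T = adjm W ** C" by (simp add: T_def adjm_mult herm)
  have TW: "adjm T ** W = mat 1" and WT: "adjm W ** T = mat 1"
    using orth by (simp add: T) (simp add: orth T_def matrix_mul_assoc)
  have right: "M = M ** W ** adjm T" if M: "\<And>x. C *v x = 0 \<Longrightarrow> M *v x = 0" for M :: "'n cmat"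
  proof -
    have "M *v x = (M ** W ** adjm T) *v x" for x
    proof -
      have "C *v (x - W *v (adjm T *v x)) = C *v x - (C ** W ** adjm W ** C) *v x"
        by (simp add: vec.diff T matrix_vector_mul_assoc matrix_mul_assoc)
      then have "M *v (x - W *v (adjm T *v x)) = 0" using M complete by simp
      then show ?thesis by (simp add: vec.diff matrix_vector_mul_assoc matrix_mul_assoc)
    qed
    then show ?thesis by (simp add: matrix_eq)
  qed
  have two_sided: "M = T ** (adjm W ** M ** W) ** adjm T"
    if M: "\<And>x. C *v x = 0 \<Longrightarrow> M *v x = 0" "\<And>x. C *v x = 0 \<Longrightarrow> adjm M *v x = 0" for M :: "'n cmat"
  proof -
    have "M = T ** adjm W ** M"
      using arg_cong[OF right[OF M(2)], of adjm] by (simp add: adjm_mult matrix_mul_assoc)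
    then show ?thesis using right[OF M(1)] by (metis matrix_mul_assoc)
  qed
  define A' B' where "A' = adjm W ** A ** W" and "B' = adjm W ** B ** W"
  have A: "A = T ** A' ** adjm T"
    unfolding A'_def by (rule two_sided) (simp_all add: kernel herm)
  have B: "B = T ** B' ** adjm T"
    unfolding B'_def using block_psd_kernel[OF psd(1)] block_psd_kernel[OF psd(2)]
    by (intro two_sided) simp_all
  have C: "C = T ** adjm T"
    unfolding T unfolding T_def by (simp add: complete matrix_mul_assoc)
  have B't: "adjm B' = adjm W ** adjm B ** W" by (simp add: B'_def adjm_mult matrix_mul_assoc)
  have pos: "0 \<le> Re (braket x (A' *v x) + 2 * braket x ((adjm W ** D ** W) *v y) + braket y y)"
    if D: "block_psd A D C" for D x y
  proof -
    have "0 \<le> Re (braket (W *v x) (A *v (W *v x)) + 2 * braket (W *v x) (D *v (W *v y))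
        + braket (W *v y) (C *v (W *v y)))"
      using D unfolding block_psd_def by blast
    moreover have "braket (W *v u) (M *v (W *v v)) = braket u ((adjm W ** M ** W) *v v)" for u v M
      by (simp add: braket_matrix matrix_vector_mul_assoc matrix_mul_assoc)
    ultimately show ?thesis by (simp add: orth A'_def)
  qed
  have hA': "adjm A' = A'" by (simp add: A'_def adjm_mult herm matrix_mul_assoc)
  have "psd (A' - B' ** adjm B')"
    using pos[OF psd(1)] by (intro schur_complement) (simp_all add: hA' flip: B'_def)
  moreover have "psd (A' - adjm B' ** adjm (adjm B'))"
    using pos[OF psd(2)] by (intro schur_complement) (simp_all add: hA' flip: B't)
  ultimately have "product_vector_in_blocks A' B' (mat 1)"
    by (intro product_vector_in_blocks_unit[OF dim]) simp_all
  then obtain a b f x y x' y' where f: "f \<noteq> 0" "a \<noteq> 0 \<or> b \<noteq> 0"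
    and sol: "A' *v x + B' *v y = a *s f" "adjm B' *v x + y = b *s f"
      "A' *v x' + adjm B' *v y' = cnj a *s f" "B' *v x' + y' = cnj b *s f"
    unfolding product_vector_in_blocks_def matrix_vector_mul_lid by blast
  have lift: "(T ** M ** adjm T) *v (W *v u) = T *v (M *v u)" for M u
  proof -
    have "(T ** M ** adjm T) *v (W *v u) = T *v (M *v ((adjm T ** W) *v u))"
      by (simp only: matrix_vector_mul_assoc matrix_mul_assoc)
    then show ?thesis by (simp add: TW)
  qed
  have lifts: "A *v (W *v u) = T *v (A' *v u)" "B *v (W *v u) = T *v (B' *v u)"
    "adjm B *v (W *v u) = T *v (adjm B' *v u)" "C *v (W *v u) = T *v u" for u
    using lift[of A' u] lift[of B' u] lift[of "adjm B'" u] lift[of "mat 1" u]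
      A B C arg_cong[OF B, of adjm]
    by (simp_all add: adjm_mult matrix_mul_assoc)
  have "T *v f \<noteq> 0"
  proof
    assume "T *v f = 0"
    then have "(adjm W ** T) *v f = 0" by (simp flip: matrix_vector_mul_assoc)
    then show False using f(1) by (simp add: WT)
  qed
  then show ?thesis
    unfolding product_vector_in_blocks_def
    using sol[THEN arg_cong[where f = "(*v) T"]] f(2)
    by (intro exI[of _ a] exI[of _ b] exI[of _ "T *v f"] exI[of _ "W *v x"] exI[of _ "W *v y"]
        exI[of _ "W *v x'"] exI[of _ "W *v y'"]) (simp add: lifts vec.add vec.scale)
qed

text \<open>Orthonormality refers to the possibly degenerate form <u, Cv>. Numbering by naturals
  lets the length vary, so that a longest family can be chosen.\<close>

definition orthonormal_family :: "'n::finite cmat \<Rightarrow> nat \<Rightarrow> (nat \<Rightarrow> 'n cvec) \<Rightarrow> bool" where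
  "orthonormal_family C r w \<longleftrightarrow> (\<forall>i<r. \<forall>j<r. braket (w i) (C *v w j) = (if i = j then 1 else 0))"

text \<open>Take a longest family; four vectors would be dependent. The Gram-Schmidt remainder of
  any \<open>x\<close> has form value zero, since otherwise its normalization would extend the
  family, so it lies in the kernel of \<open>C\<close>.\<close>

lemma complete_orthonormal_family:
  fixes C :: "'n::finite cmat"
  assumes C: "psd C" "C \<noteq> 0" and dim: "CARD('n) \<le> 3"
  shows "\<exists>r w. 1 \<le> r \<and> r \<le> 3 \<and> orthonormal_family C r w \<and>
    (\<forall>x. C *v x = (\<Sum>i<r. braket (w i) (C *v x) *s (C *v w i)))"
proof -
  let ?P = "\<lambda>r. \<exists>w. orthonormal_family C r w"
  have bound: "r \<le> 3" if on: "orthonormal_family C r w" for r w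
  proof (rule ccontr)
    assume "\<not> r \<le> 3"
    then have r: "0 < r" "1 < r" "2 < r" "3 < r" by auto
    obtain a b c d where nz: "a \<noteq> 0 \<or> b \<noteq> 0 \<or> c \<noteq> 0 \<or> d \<noteq> 0"
      and eq: "a *s w 0 + b *s w 1 + c *s w 2 + d *s w 3 = 0"
      using four_vectors_dependent[OF dim] by metis
    have "braket (w i) (C *v (a *s w 0 + b *s w 1 + c *s w 2 + d *s w 3)) = 0" for i
      by (simp only: eq vec.zero braket_zero_right)
    then have "a * braket (w i) (C *v w 0) + b * braket (w i) (C *v w 1)
        + c * braket (w i) (C *v w 2) + d * braket (w i) (C *v w 3) = 0" for i
      by (simp add: vec.add vec.scale braket_linear)
    from this[of 0] this[of 1] this[of 2] this[of 3] show False
      using nz on r unfolding orthonormal_family_def by (simp add: numeral_eq_Suc)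
  qed
  have "?P 0" by (simp add: orthonormal_family_def)
  then obtain r where "?P r" and greatest: "\<And>s. ?P s \<Longrightarrow> s \<le> r"
    using Nat.ex_has_greatest_nat[of ?P 0 3] bound by auto
  then obtain w where w: "orthonormal_family C r w" by blast
  have complete: "C *v x = (\<Sum>i<r. braket (w i) (C *v x) *s (C *v w i))" for x
  proof -
    define x' where "x' = x - (\<Sum>i<r. braket (w i) (C *v x) *s w i)"
    have wx': "braket (w j) (C *v x') = 0" if "j < r" for j
    proof -
      have "braket (w j) (C *v x') = braket (w j) (C *v x)
          - (\<Sum>i<r. braket (w i) (C *v x) * braket (w j) (C *v w i))"
        by (simp add: x'_def vec.diff vec.sum vec.scale braket_linear braket_sum_right)
      also have "(\<Sum>i<r. braket (w i) (C *v x) * braket (w j) (C *v w i))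
          = (\<Sum>i<r. if i = j then braket (w i) (C *v x) else 0)"
        using w that unfolding orthonormal_family_def by (intro sum.cong) auto
      finally show ?thesis using that by simp
    qed
    have "Re (braket x' (C *v x')) = 0"
    proof (rule ccontr)
      assume nz: "Re (braket x' (C *v x')) \<noteq> 0"
      define t where "t = Re (braket x' (C *v x'))"
      have t: "t > 0" using nz psd_nonneg[OF C(1), of x'] by (simp add: t_def)
      have xx: "braket x' (C *v x') = of_real t" using psd_braket_real[OF C(1)] by (simp add: t_def)
      define e where "e = of_real (1 / sqrt t) *s x'"
      have ee: "braket e (C *v e) = 1"
        using t by (simp add: e_def vec.scale braket_linear xx flip: of_real_mult)
      have we: "braket (w j) (C *v e) = 0" "braket e (C *v w j) = 0" if "j < r" for j
      proof -
        show *: "braket (w j) (C *v e) = 0" using wx' that by (simp add: e_def vec.scale braket_linear)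
        show "braket e (C *v w j) = 0"
          using * psd_sym[OF C(1)] by (metis cnj_braket complex_cnj_zero)
      qed
      have "orthonormal_family C (Suc r) (w(r := e))"
        using w ee we unfolding orthonormal_family_def by (auto simp: less_Suc_eq)
      then show False using greatest by force
    qed
    then have "C *v x' = 0" by (rule psd_null[OF C(1)])
    then show ?thesis by (simp add: x'_def vec.diff vec.sum vec.scale)
  qed
  have "r \<noteq> 0"
  proof
    assume "r = 0"
    then have "C *v x = 0" for x using complete[of x] by simp
    then show False using C(2) by (simp add: matrix_eq)
  qed
  then show ?thesis using w bound[OF w] complete by (intro exI[of _ r] exI[of _ w]) auto
qed

text \<open>The family supplies the columns of \<open>W\<close>. The size of a matrix is part of its
  type, so the columns are indexed by a type with r elements.\<close>

lemma product_vector_in_blocks_of_family: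
  fixes w :: "nat \<Rightarrow> 'n::finite cvec"
  assumes psd: "block_psd A B C" "block_psd A (adjm B) C"
    and kernel: "\<And>x. C *v x = 0 \<Longrightarrow> A *v x = 0"
    and on: "orthonormal_family C r w"
    and complete: "\<And>x. C *v x = (\<Sum>i<r. braket (w i) (C *v x) *s (C *v w i))"
    and r: "CARD('r::finite) = r" "r \<le> 3"
  shows "product_vector_in_blocks A B C"
proof -
  obtain h :: "'r \<Rightarrow> nat" where h: "bij_betw h UNIV {..<r}"
    using finite_same_card_bij[of "UNIV :: 'r set" "{..<r}"] r by auto
  define W :: "complex ^ 'r ^ 'n" where "W = (\<chi> i k. w (h k) $ i)"
  have hr: "h k < r" "h k = h l \<longleftrightarrow> k = l" for k l
    using h by (auto simp: bij_betw_def inj_def)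
  have Wl: "(adjm W *v v) $ k = braket (w (h k)) v" for v k
    by (simp add: W_def matrix_vector_mult_def braket_def)
  have Wr: "M *v (W *v x) = (\<Sum>k\<in>UNIV. x $ k *s (M *v w (h k)))" for M :: "'n cmat" and x
  proof -
    have "W *v x = (\<Sum>k\<in>UNIV. x $ k *s w (h k))"
      by (simp add: vec_eq_iff W_def matrix_vector_mult_def mult.commute)
    then show ?thesis by (simp add: vec.sum vec.scale)
  qed
  have "adjm W ** C ** W = mat 1"
  proof -
    have "(adjm W ** C ** W) $ k $ l = (adjm W *v (C *v w (h l))) $ k" for k l
      by (simp add: matrix_matrix_mult_def matrix_vector_mult_def W_def sum_distrib_right
          sum_distrib_left mult.assoc)
        (rule sum.swap)
    also have "\<dots> k l = (mat 1 :: complex ^ 'r ^ 'r) $ k $ l" for k l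
      using on hr unfolding orthonormal_family_def by (simp add: Wl mat_def)
    finally show ?thesis by (simp add: vec_eq_iff)
  qed
  moreover have "C ** W ** adjm W ** C = C"
  proof -
    have "(C ** W ** adjm W ** C) *v x = C *v x" for x
    proof -
      have "(C ** W ** adjm W ** C) *v x = C *v (W *v (adjm W *v (C *v x)))"
        by (simp only: matrix_vector_mul_assoc matrix_mul_assoc)
      also have "\<dots> = (\<Sum>k\<in>UNIV. braket (w (h k)) (C *v x) *s (C *v w (h k)))"
        by (simp add: Wr Wl)
      also have "\<dots> = (\<Sum>i<r. braket (w i) (C *v x) *s (C *v w i))"
        by (rule sum.reindex_bij_betw[OF h])
      finally show ?thesis using complete by simp
    qed
    then show ?thesis by (simp add: matrix_eq)
  qed
  ultimately show ?thesis
    using product_vector_in_blocks_compressed[OF _ psd kernel] r by blast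
qed

text \<open>If \<open>C\<close> kills some \<open>f\<close> that \<open>A\<close> does not, then
  \<open>B\<close> and \<open>adjm B\<close> kill it too, and \<open>A *v f\<close> with (a, b) =
  (1, 0) works. Otherwise compression applies, with one, two or three columns.\<close>

lemma product_vector_in_blocks:
  fixes A B C :: "'n::finite cmat"
  assumes dim: "CARD('n) \<le> 3" and psd: "block_psd A B C" "block_psd A (adjm B) C"
    and nz: "A \<noteq> 0 \<or> C \<noteq> 0"
  shows "product_vector_in_blocks A B C"
proof (cases "\<exists>f. C *v f = 0 \<and> A *v f \<noteq> 0")
  case True
  then obtain f where f: "C *v f = 0" "A *v f \<noteq> 0" by blast
  then have "B *v f = 0" "adjm B *v f = 0"
    using block_psd_kernel psd by blast+
  then have "A *v f + B *v 0 = 1 *s (A *v f)" "adjm B *v f + C *v 0 = 0 *s (A *v f)"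
    "A *v f + adjm B *v 0 = cnj 1 *s (A *v f)" "B *v f + C *v 0 = cnj 0 *s (A *v f)"
    by simp_all
  then show ?thesis
    unfolding product_vector_in_blocks_def using f(2) zero_neq_one by metis
next
  case False
  then have kernel: "A *v x = 0" if "C *v x = 0" for x using that by blast
  have "C \<noteq> 0" using nz kernel by (auto simp: matrix_eq)
  then obtain r w where r: "1 \<le> r" "r \<le> 3" and w: "orthonormal_family C r w"
    "\<And>x. C *v x = (\<Sum>i<r. braket (w i) (C *v x) *s (C *v w i))"
    using complete_orthonormal_family[OF block_psd_snd[OF psd(1)] _ dim] by blast
  from r consider "r = CARD(1)" | "r = CARD(2)" | "r = CARD(3)"
    by (auto simp: le_Suc_eq numeral_eq_Suc)
  then show ?thesis
  proof cases
    case 1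
    then show ?thesis
      using product_vector_in_blocks_of_family[where ?'r = 1, OF psd kernel w _ r(2)] by simp
  next
    case 2
    then show ?thesis
      using product_vector_in_blocks_of_family[where ?'r = 2, OF psd kernel w _ r(2)] by simp
  next
    case 3
    then show ?thesis
      using product_vector_in_blocks_of_family[where ?'r = 3, OF psd kernel w _ r(2)] by simp
  qed
qed

section \<open>Positive partial transpose implies separability\<close>

definition cnjv :: "complex ^ 'n \<Rightarrow> complex ^ 'n" where
  "cnjv v = (\<chi> i. cnj (v $ i))"

lemma cnjv_nth [simp]: "cnjv v $ i = cnj (v $ i)"
  by (simp add: cnjv_def)

lemma sum_UNIV_prod:
  fixes f :: "'a::finite \<times> 'b::finite \<Rightarrow> 'c::comm_monoid_add"
  shows "(\<Sum>p\<in>UNIV. f p) = (\<Sum>i\<in>UNIV. \<Sum>j\<in>UNIV. f (i, j))"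
  by (simp add: sum.cartesian_product)

text \<open>The conjugate matches the partial transpose of the projector of
  \<open>tensor_vec u v\<close>, which is the projector of \<open>tensor_vec u (cnjv v)\<close>;
  hence one subtraction serves both matrices.\<close>

definition ranges_share_product :: "('a::finite \<times> 'b::finite) cmat \<Rightarrow> bool" where
  "ranges_share_product X \<longleftrightarrow> (\<exists>u v w w'. u \<noteq> 0 \<and> v \<noteq> 0 \<and> X *v w = tensor_vec u v \<and>
    ptranspose_snd X *v w' = tensor_vec u (cnjv v))"

lemma psd_hermitian: "psd M \<Longrightarrow> cnj (M $ i $ j) = M $ j $ i"
  unfolding psd_def by metis

text \<open>Over a basis of the two-dimensional factor \<open>X\<close> is a 2 x 2 block matrix, and
  partial transposition exchanges its off-diagonal blocks.\<close>

lemma ranges_share_product_qubit_snd: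
  fixes X :: "('a::finite \<times> 'b::finite) cmat"
  assumes b: "CARD('b) = 2" and a: "CARD('a) \<le> 3"
    and X: "psd X" "psd (ptranspose_snd X)" "X \<noteq> 0"
  shows "ranges_share_product X"
proof -
  obtain c0 c1 :: 'b where c: "c0 \<noteq> c1" "UNIV = {c0, c1}"
    using b by (auto simp: card_2_iff)
  define block where "block M d d' = (\<chi> i j. M $ (i, d) $ (j, d'))"
    for M :: "('a \<times> 'b) cmat" and d d'
  define join where "join x y = (\<chi> p. if snd p = c0 then x $ fst p else y $ fst p)"
    for x y :: "'a cvec"
  have sumb: "(\<Sum>d\<in>UNIV. f d) = f c0 + f c1" for f :: "'b \<Rightarrow> complex"
    using c(1) by (simp add: c(2))
  have cases: "d = c0 \<or> d = c1" for d using c(2) by auto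
  have entry: "(M *v join x y) $ (i, d) = (block M d c0 *v x) $ i + (block M d c1 *v y) $ i"
    for M x y i d
    using c(1) by (simp add: matrix_vector_mult_def sum_UNIV_prod sumb join_def block_def sum.distrib)
  have herm: "block M c1 c0 = adjm (block M c0 c1)" if "psd M" for M
    using psd_hermitian[OF that] by (simp add: block_def vec_eq_iff)
  have bpsd: "block_psd (block M c0 c0) (block M c0 c1) (block M c1 c1)" if M: "psd M" for M
    unfolding block_psd_def
  proof (intro conjI allI)
    show "adjm (block M c0 c0) = block M c0 c0" "adjm (block M c1 c1) = block M c1 c1"
      using psd_hermitian[OF M] by (simp_all add: block_def vec_eq_iff)
    fix x y
    have "braket (join x y) (M *v join x y)
        = braket x (block M c0 c0 *v x + block M c0 c1 *v y)
        + braket y (block M c1 c0 *v x + block M c1 c1 *v y)"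
      using c(1) by (simp add: braket_def[of "join x y"] sum_UNIV_prod sumb entry)
        (simp add: join_def braket_def sum.distrib)
    moreover have "Re (braket y (block M c1 c0 *v x)) = Re (braket x (block M c0 c1 *v y))"
    proof -
      have "braket y (block M c1 c0 *v x) = cnj (braket x (block M c0 c1 *v y))"
        unfolding herm[OF M] cnj_braket by (simp add: braket_adjm')
      then show ?thesis by (simp del: cnj_braket)
    qed
    ultimately show "0 \<le> Re (braket x (block M c0 c0 *v x) + 2 * braket x (block M c0 c1 *v y)
        + braket y (block M c1 c1 *v y))"
      using psd_nonneg[OF M, of "join x y"] by (simp add: braket_linear)
  qed
  let ?A = "block X c0 c0" and ?B = "block X c0 c1" and ?C = "block X c1 c1"
  have pt: "block (ptranspose_snd X) d d' = block X d' d" for d d'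
    by (simp add: block_def ptranspose_snd_def)
  have "?A \<noteq> 0 \<or> ?C \<noteq> 0"
  proof (rule ccontr)
    assume "\<not> ?thesis"
    then have "X $ (i, d) $ (i, d) = 0" for i d
      using cases[of d] by (auto simp: block_def vec_eq_iff)
    then have "Re (trace X) = 0" by (simp add: trace_def sum_UNIV_prod)
    then show False using psd_trace_eq_0 X by blast
  qed
  then have "product_vector_in_blocks ?A ?B ?C"
    using product_vector_in_blocks[OF a bpsd[OF X(1)]] bpsd[OF X(2)] unfolding pt herm[OF X(1)]
    by blast
  then obtain e0 e1 f x y x' y' where f: "f \<noteq> 0" "e0 \<noteq> 0 \<or> e1 \<noteq> 0"
    and sol: "?A *v x + ?B *v y = e0 *s f" "adjm ?B *v x + ?C *v y = e1 *s f"
      "?A *v x' + adjm ?B *v y' = cnj e0 *s f" "?B *v x' + ?C *v y' = cnj e1 *s f"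
    unfolding product_vector_in_blocks_def by blast
  define v :: "'b cvec" where "v = (\<chi> d. if d = c0 then e0 else e1)"
  have "v \<noteq> 0" using f(2) c(1) by (auto simp: v_def vec_eq_iff)
  moreover have "X *v join x y = tensor_vec f v"
    unfolding vec_eq_iff
  proof
    fix p :: "'a \<times> 'b"
    show "(X *v join x y) $ p = tensor_vec f v $ p"
      using cases[of "snd p"] c(1) arg_cong[OF sol(1), of "\<lambda>z. z $ fst p"]
        arg_cong[OF sol(2), of "\<lambda>z. z $ fst p"]
      by (cases p) (auto simp: entry tensor_vec_def v_def herm[OF X(1)] mult.commute)
  qed
  moreover have "ptranspose_snd X *v join x' y' = tensor_vec f (cnjv v)"
    unfolding vec_eq_iff
  proof
    fix p :: "'a \<times> 'b"
    show "(ptranspose_snd X *v join x' y') $ p = tensor_vec f (cnjv v) $ p"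
      using cases[of "snd p"] c(1) arg_cong[OF sol(3), of "\<lambda>z. z $ fst p"]
        arg_cong[OF sol(4), of "\<lambda>z. z $ fst p"]
      by (cases p) (auto simp: entry pt tensor_vec_def v_def herm[OF X(1)] mult.commute)
  qed
  ultimately show ?thesis using f(1) unfolding ranges_share_product_def by blast
qed

section \<open>Exchange of the two tensor factors\<close>

definition swapm :: "('a::finite \<times> 'b::finite) cmat \<Rightarrow> ('b \<times> 'a) cmat" where
  "swapm X = (\<chi> p q. X $ prod.swap p $ prod.swap q)"

definition swapv :: "('a::finite \<times> 'b::finite) cvec \<Rightarrow> ('b \<times> 'a) cvec" where
  "swapv w = (\<chi> p. w $ prod.swap p)"

lemma sum_UNIV_swap:
  fixes f :: "'a::finite \<times> 'b::finite \<Rightarrow> 'c::comm_monoid_add"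
  shows "(\<Sum>q\<in>UNIV. f (prod.swap q)) = (\<Sum>q\<in>UNIV. f q)"
  by (rule sum.reindex_bij_betw) (simp add: bij_betw_def)

lemma swapm_mult: "X *v swapv w = swapv (swapm X *v w)"
proof -
  have "(\<Sum>q\<in>UNIV. X $ p $ q * w $ prod.swap q) = (\<Sum>q\<in>UNIV. X $ p $ prod.swap q * w $ q)" for p
    using sum_UNIV_swap[of "\<lambda>q. X $ p $ q * w $ prod.swap q"] by simp
  then show ?thesis by (simp add: vec_eq_iff swapv_def swapm_def matrix_vector_mult_def)
qed

lemma psd_swapm:
  assumes "psd X"
  shows "psd (swapm X)"
proof (rule psdI)
  show "adjm (swapm X) = swapm X"
    using psd_hermitian[OF assms] by (simp add: vec_eq_iff swapm_def)
  fix v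
  have "braket (swapv v) (swapv (swapm X *v v)) = braket v (swapm X *v v)"
    using sum_UNIV_swap[of "\<lambda>p. cnj (v $ p) * (swapm X *v v) $ p"]
    by (simp add: braket_def swapv_def)
  then show "0 \<le> Re (braket v (swapm X *v v))"
    using psd_nonneg[OF assms, of "swapv v"] by (simp add: swapm_mult)
qed

lemma cnj_mult_vec: "(\<chi> i j. cnj (M $ i $ j)) *v v = cnjv (M *v cnjv v)"
  for M :: "complex ^ 'n::finite ^ 'm::finite"
  by (simp add: vec_eq_iff matrix_vector_mult_def)

lemma psd_cnj:
  fixes M :: "'n::finite cmat"
  assumes "psd M"
  shows "psd (\<chi> i j. cnj (M $ i $ j))"
proof (rule psdI)
  show "adjm (\<chi> i j. cnj (M $ i $ j)) = (\<chi> i j. cnj (M $ i $ j))"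
    using psd_hermitian[OF assms] by (simp add: vec_eq_iff)
  fix v :: "'n cvec"
  have "braket v (cnjv w) = cnj (braket (cnjv v) w)" for w
    by (simp add: braket_def)
  then show "0 \<le> Re (braket v ((\<chi> i j. cnj (M $ i $ j)) *v v))"
    using psd_nonneg[OF assms] by (simp add: cnj_mult_vec del: cnj_braket)
qed

text \<open>Transposing one factor or the other differs by a full transposition, which for a
  Hermitian matrix is entrywise conjugation.\<close>

lemma ptranspose_swapm:
  assumes "psd X"
  shows "ptranspose_snd (swapm X) = (\<chi> p q. cnj (swapm (ptranspose_snd X) $ p $ q))"
  using psd_hermitian[OF assms] by (simp add: vec_eq_iff ptranspose_snd_def swapm_def)

text \<open>Conjugating the second condition entrywise moves the conjugation from \<open>v\<close>
  to \<open>u\<close>, which is the second factor after the exchange.\<close>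

lemma ranges_share_product_swap:
  assumes X: "psd X" and swap: "ranges_share_product (swapm X)"
  shows "ranges_share_product X"
proof -
  obtain u v w w' where uv: "u \<noteq> 0" "v \<noteq> 0" "swapm X *v w = tensor_vec u v"
    "ptranspose_snd (swapm X) *v w' = tensor_vec u (cnjv v)"
    using swap unfolding ranges_share_product_def by blast
  have "X *v swapv w = tensor_vec v u"
    unfolding swapm_mult uv by (simp add: vec_eq_iff swapv_def tensor_vec_def mult.commute)
  moreover have "swapm (ptranspose_snd X) *v cnjv w' = cnjv (tensor_vec u (cnjv v))"
    using uv(4) unfolding ptranspose_swapm[OF X] cnj_mult_vec
    by (metis (no_types, lifting) cnjv_def cnjv_nth complex_cnj_cnj vec_eq_iff)
  then have "ptranspose_snd X *v swapv (cnjv w') = tensor_vec v (cnjv u)"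
    unfolding swapm_mult by (simp add: vec_eq_iff swapv_def tensor_vec_def mult.commute)
  ultimately show ?thesis using uv unfolding ranges_share_product_def by blast
qed

text \<open>With a one-dimensional first factor every vector is a product, and partial transposition
  is full transposition, that is, conjugation of a Hermitian matrix.\<close>

lemma ranges_share_product_trivial_fst:
  fixes X :: "('a::finite \<times> 'b::finite) cmat"
  assumes a: "CARD('a) = 1" and X: "psd X" "X \<noteq> 0"
  shows "ranges_share_product X"
proof -
  obtain a0 :: 'a where a0: "UNIV = {a0}" using a by (auto simp: card_1_singleton_iff)
  then have all: "d = a0" for d by auto
  obtain w where w: "X *v w \<noteq> 0" using X(2) by (metis matrix_eq matrix_vector_mult_0)
  define v where "v = (\<chi> i. (X *v w) $ (a0, i))"
  have 1: "X *v w = tensor_vec 1 v"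
    unfolding vec_eq_iff
  proof
    fix p :: "'a \<times> 'b"
    obtain i where "p = (a0, i)" using all by (metis surj_pair)
    then show "(X *v w) $ p = tensor_vec 1 v $ p" by (simp add: tensor_vec_def v_def)
  qed
  have "ptranspose_snd X = (\<chi> p q. cnj (X $ p $ q))"
    unfolding vec_eq_iff
  proof (intro allI)
    fix p q :: "'a \<times> 'b"
    obtain i j where "p = (a0, i)" "q = (a0, j)" using all by (metis surj_pair)
    then show "ptranspose_snd X $ p $ q = (\<chi> p q. cnj (X $ p $ q)) $ p $ q"
      using psd_hermitian[OF X(1)] by (simp add: ptranspose_snd_def)
  qed
  then have "ptranspose_snd X *v cnjv w = cnjv (X *v cnjv (cnjv w))"
    by (simp add: cnj_mult_vec)
  also have "cnjv (cnjv w) = w" by (simp add: vec_eq_iff)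
  also have "cnjv (X *v w) = tensor_vec 1 (cnjv v)"
    by (simp add: 1 vec_eq_iff tensor_vec_def)
  finally have "ptranspose_snd X *v cnjv w = tensor_vec 1 (cnjv v)" .
  moreover have "v \<noteq> 0" using w 1 by (auto simp: tensor_vec_def vec_eq_iff)
  ultimately show ?thesis using 1 unfolding ranges_share_product_def
    by (metis zero_neq_one)
qed

text \<open>The first alternative serves pure states, whose purifying system is
  one-dimensional.\<close>

definition ppt_dims :: "'a::finite itself \<Rightarrow> 'b::finite itself \<Rightarrow> bool" where
  "ppt_dims _ _ \<longleftrightarrow> CARD('a) = 1 \<or> CARD('a) = 2 \<and> CARD('b) \<le> 3 \<or> CARD('b) = 2 \<and> CARD('a) \<le> 3"

lemma ppt_ranges_share_product:
  fixes X :: "('a::finite \<times> 'b::finite) cmat"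
  assumes dims: "ppt_dims TYPE('a) TYPE('b)"
    and X: "psd X" "psd (ptranspose_snd X)" "X \<noteq> 0"
  shows "ranges_share_product X"
proof -
  consider "CARD('a) = 1" | "CARD('a) = 2" "CARD('b) \<le> 3" | "CARD('b) = 2" "CARD('a) \<le> 3"
    using dims unfolding ppt_dims_def by blast
  then show ?thesis
  proof cases
    case 1
    then show ?thesis using ranges_share_product_trivial_fst X by blast
  next
    case 2
    have "psd (ptranspose_snd (swapm X))"
      unfolding ptranspose_swapm[OF X(1)] by (intro psd_cnj psd_swapm X)
    moreover have "swapm X \<noteq> 0"
      using X(3) by (auto simp: swapm_def vec_eq_iff)
    ultimately have "ranges_share_product (swapm X)"
      using ranges_share_product_qubit_snd[OF 2 psd_swapm[OF X(1)]] by blast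
    then show ?thesis using ranges_share_product_swap X(1) by blast
  next
    case 3
    then show ?thesis using ranges_share_product_qubit_snd X by blast
  qed
qed

section \<open>Normalized states with positive partial transpose and their extreme points\<close>

lemma ptranspose_snd_linear:
  "ptranspose_snd (X + Y) = ptranspose_snd X + ptranspose_snd Y"
  "ptranspose_snd (X - Y) = ptranspose_snd X - ptranspose_snd Y"
  "ptranspose_snd (c *\<^sub>R X) = c *\<^sub>R ptranspose_snd X"
  by (simp_all add: vec_eq_iff ptranspose_snd_def)

lemma trace_scaleR: "trace (c *\<^sub>R M) = of_real c * trace M"
  for M :: "complex ^ 'n::finite ^ 'n"
  by (simp add: trace_def scaleR_sum_right[symmetric] scaleR_conv_of_real[symmetric])

lemma ptranspose_projector:
  "ptranspose_snd (projector (tensor_vec u v)) = projector (tensor_vec u (cnjv v))"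
  by (simp add: vec_eq_iff ptranspose_snd_def projector_def tensor_vec_def)

lemma trace_projector: "trace (projector z) = of_real ((norm z)\<^sup>2)"
  by (simp add: projector_eq_outer trace_outer braket_self)

lemma projector_scaleR: "projector (r *\<^sub>R z) = r\<^sup>2 *\<^sub>R projector z"
  by (simp add: vec_eq_iff projector_def power2_eq_square)

lemma tensor_vec_scaleR: "tensor_vec (r *\<^sub>R u) v = r *\<^sub>R tensor_vec u v"
  "tensor_vec u (r *\<^sub>R v) = r *\<^sub>R tensor_vec u v"
  by (simp_all add: vec_eq_iff tensor_vec_def)

lemma tensor_vec_eq_0: "tensor_vec u v = 0 \<longleftrightarrow> u = 0 \<or> v = 0"
  by (auto simp: vec_eq_iff tensor_vec_def)

definition ppt_states :: "('a::finite \<times> 'b::finite) cmat set" where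
  "ppt_states = {X. psd X \<and> psd (ptranspose_snd X) \<and> Re (trace X) = 1}"

lemma convex_ppt_states: "convex ppt_states"
  unfolding convex_def ppt_states_def
  by (auto simp: ptranspose_snd_linear trace_add trace_scaleR intro!: psd_add psd_scaleR)

lemma closed_psd:
  fixes f :: "'n::finite cmat \<Rightarrow> 'm::finite cmat"
  assumes "\<And>i j. continuous_on UNIV (\<lambda>X. f X $ i $ j)"
  shows "closed {X. psd (f X)}"
  unfolding psd_def braket_def matrix_vector_mult_def vec_lambda_beta
  by (intro closed_Collect_conj closed_Collect_all closed_Collect_eq closed_Collect_le
      continuous_intros assms)

lemma compact_ppt_states: "compact (ppt_states :: ('a::finite \<times> 'b::finite) cmat set)"
proof -
  have "closed (ppt_states :: ('a \<times> 'b) cmat set)"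
    unfolding ppt_states_def
  proof (intro closed_Collect_conj)
    show "closed {X :: ('a \<times> 'b) cmat. psd X}"
      by (rule closed_psd) (intro continuous_intros)
    show "closed {X :: ('a \<times> 'b) cmat. psd (ptranspose_snd X)}"
      by (rule closed_psd) (simp add: ptranspose_snd_def, intro continuous_intros)
    show "closed {X :: ('a \<times> 'b) cmat. Re (trace X) = 1}"
      unfolding trace_def by (intro closed_Collect_eq continuous_intros)
  qed
  moreover have "bounded (ppt_states :: ('a \<times> 'b) cmat set)"
  proof (rule boundedI)
    fix X :: "('a \<times> 'b) cmat" assume "X \<in> ppt_states"
    then have le: "cmod (X $ p $ q) \<le> 1" for p q
      using psd_entry_le_trace[of X p q] by (simp add: ppt_states_def)
    have "norm X \<le> (\<Sum>p\<in>UNIV. norm (X $ p))"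
      unfolding norm_vec_def[of X] by (rule L2_set_le_sum) simp
    also have "\<dots> \<le> (\<Sum>p\<in>(UNIV :: ('a \<times> 'b) set). \<Sum>q\<in>(UNIV :: ('a \<times> 'b) set). 1)"
    proof (rule sum_mono)
      fix p
      have "norm (X $ p) \<le> (\<Sum>q\<in>UNIV. cmod (X $ p $ q))"
        unfolding norm_vec_def[of "X $ p"] by (rule L2_set_le_sum) simp
      also have "\<dots> \<le> (\<Sum>q\<in>(UNIV :: ('a \<times> 'b) set). 1)"
        by (rule sum_mono) (rule le)
      finally show "norm (X $ p) \<le> (\<Sum>q\<in>(UNIV :: ('a \<times> 'b) set). 1)" .
    qed
    finally show "norm X \<le> (\<Sum>p\<in>(UNIV :: ('a \<times> 'b) set). \<Sum>q\<in>(UNIV :: ('a \<times> 'b) set). 1)" .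
  qed
  ultimately show ?thesis by (simp add: compact_eq_bounded_closed)
qed

text \<open>Subtracting a small multiple of the shared product projector preserves both positivity
  conditions. So \<open>X\<close> is a proper convex combination of a product state \<open>Y\<close>
  and a remainder \<open>X'\<close>, and extremality gives X = Y.\<close>

lemma extreme_ppt_state_product:
  fixes X :: "('a::finite \<times> 'b::finite) cmat"
  assumes dims: "ppt_dims TYPE('a) TYPE('b)" and ext: "X extreme_point_of ppt_states"
  shows "\<exists>u v. norm v = 1 \<and> X = projector (tensor_vec u v)"
proof -
  have XS: "X \<in> ppt_states" using ext by (simp add: extreme_point_of_def)
  then have X: "psd X" "psd (ptranspose_snd X)" "Re (trace X) = 1" by (simp_all add: ppt_states_def)
  then have "X \<noteq> 0" by (auto simp: trace_def)
  then obtain u v w w' where uv: "u \<noteq> 0" "v \<noteq> 0" "X *v w = tensor_vec u v"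
    "ptranspose_snd X *v w' = tensor_vec u (cnjv v)"
    using ppt_ranges_share_product[OF dims X(1,2)] unfolding ranges_share_product_def by blast
  define z where "z = tensor_vec u v"
  have z: "z \<noteq> 0" by (simp add: z_def tensor_vec_eq_0 uv)
  define t where "t = (norm z)\<^sup>2"
  have t: "t > 0" using z by (simp add: t_def)
  obtain e1 where e1: "e1 > 0" "\<And>d. 0 \<le> d \<Longrightarrow> d \<le> e1 \<Longrightarrow> psd (X - d *\<^sub>R projector z)"
    using psd_sub_range[OF X(1) uv(3)[symmetric]] unfolding z_def by blast
  obtain e2 where e2: "e2 > 0"
    "\<And>d. 0 \<le> d \<Longrightarrow> d \<le> e2 \<Longrightarrow> psd (ptranspose_snd X - d *\<^sub>R projector (tensor_vec u (cnjv v)))"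
    using psd_sub_range[OF X(2) uv(4)[symmetric]] by blast
  \<comment> \<open>The first two bounds keep both matrices positive; the third gives s = d t \<le>
    1/2, so that the remainder has positive trace.\<close>
  define d where "d = min (min e1 e2) (1 / (2 * t))"
  have d: "d > 0" "d \<le> e1" "d \<le> e2" "d \<le> 1 / (2 * t)" using e1 e2 t by (auto simp: d_def)
  define s where "s = d * t"
  have s: "0 < s" "s < 1" using d t by (auto simp: s_def field_simps)
  define Y where "Y = (1 / t) *\<^sub>R projector z"
  define X' where "X' = (1 / (1 - s)) *\<^sub>R (X - d *\<^sub>R projector z)"
  have "Y \<in> ppt_states"
    using t by (auto simp: ppt_states_def Y_def ptranspose_snd_linear z_def ptranspose_projector
        trace_scaleR psd_projector intro!: psd_scaleR)
      (simp add: trace_projector t_def z_def)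
  moreover have "X' \<in> ppt_states"
  proof -
    have "psd (X - d *\<^sub>R projector z)" using e1 d by simp
    moreover have "psd (ptranspose_snd (X - d *\<^sub>R projector z))"
      using e2 d by (simp add: ptranspose_snd_linear z_def ptranspose_projector)
    moreover have "Re (trace (X - d *\<^sub>R projector z)) = 1 - s"
      by (simp add: trace_sub trace_scaleR trace_projector X s_def t_def)
    ultimately show ?thesis
      using s by (simp add: ppt_states_def X'_def ptranspose_snd_linear(3) trace_scaleR psd_scaleR)
  qed
  ultimately have not: "X \<notin> open_segment X' Y"
    using ext by (simp add: extreme_point_of_def)
  have comb: "X = (1 - s) *\<^sub>R X' + s *\<^sub>R Y"
    using s t by (simp add: X'_def Y_def s_def)
  then have "X' = Y"
    using not s unfolding in_segment by blast
  then have "X = Y" using comb by (simp flip: scaleR_add_left)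
  \<comment> \<open>The normalization goes into the first factor, so that the second is a unit
    vector.\<close>
  moreover have "Y = projector (tensor_vec ((norm v / sqrt t) *\<^sub>R u) (sgn v))"
    using t uv(2)
    by (simp add: Y_def z_def tensor_vec_scaleR sgn_div_norm projector_scaleR power_divide
        power_mult_distrib)
  moreover have "norm (sgn v) = 1" using uv(2) by (simp add: norm_sgn)
  ultimately show ?thesis by blast
qed

text \<open>In finite dimension a compact convex set is the convex hull of its extreme points, so
  finitely many products suffice. The weights are absorbed into \<open>u\<close>, which makes the
  reduced matrix the sum of the projectors of the \<open>u i\<close>.\<close>

theorem ppt_separable:
  fixes X :: "('a::finite \<times> 'b::finite) cmat"
  assumes dims: "ppt_dims TYPE('a) TYPE('b)" and X: "psd X" "psd (ptranspose_snd X)"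
  shows "\<exists>(n::nat) u v. X = (\<Sum>i\<in>{1..n}. projector (tensor_vec (u i) (v i))) \<and> (\<forall>i\<in>{1..n}. norm (v i) = 1)"
proof (cases "X = 0")
  case True
  then show ?thesis by (intro exI[of _ 0]) simp
next
  case False
  define \<tau> where "\<tau> = Re (trace X)"
  have \<tau>: "\<tau> > 0" using psd_trace_nonneg[OF X(1)] psd_trace_eq_0[OF X(1)] False
    by (auto simp: \<tau>_def less_le)
  have "(1 / \<tau>) *\<^sub>R X \<in> ppt_states"
    using X \<tau> by (simp add: ppt_states_def psd_scaleR ptranspose_snd_linear trace_scaleR \<tau>_def)
  then have "(1 / \<tau>) *\<^sub>R X \<in> convex hull {Y. Y extreme_point_of ppt_states}"
    using Krein_Milman_Minkowski[OF compact_ppt_states convex_ppt_states] by metis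
  then obtain n c x where c: "\<forall>i\<in>{1::nat..n}. 0 \<le> c i \<and> x i extreme_point_of ppt_states"
    and eq: "(\<Sum>i = 1..n. c i *\<^sub>R x i) = (1 / \<tau>) *\<^sub>R X"
    unfolding convex_hull_indexed by auto
  have "\<forall>i\<in>{1..n}. \<exists>u v. norm v = 1 \<and> x i = projector (tensor_vec u v)"
    using extreme_ppt_state_product[OF dims] c by blast
  then obtain u v where uv: "\<And>i. i \<in> {1..n} \<Longrightarrow> norm (v i) = 1 \<and> x i = projector (tensor_vec (u i) (v i))"
    by metis
  have "X = \<tau> *\<^sub>R (\<Sum>i = 1..n. c i *\<^sub>R x i)" unfolding eq using \<tau> by simp
  also have "\<dots> = (\<Sum>i = 1..n. projector (tensor_vec (sqrt (\<tau> * c i) *\<^sub>R u i) (v i)))"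
    unfolding scaleR_sum_right
    using \<tau> c uv by (intro sum.cong) (simp_all add: tensor_vec_scaleR projector_scaleR)
  finally show ?thesis using uv
    by (intro exI[of _ n] exI[of _ "\<lambda>i. sqrt (\<tau> * c i) *\<^sub>R u i"] exI[of _ v]) simp
qed

section \<open>Geometric entanglement of the steered ensemble\<close>

text \<open>The partial inner product with \<open>x\<close> on the first factor, antilinear in
  \<open>x\<close>: up to normalization, the state left after outcome \<open>x\<close>.\<close>

definition contract_fst :: "'a::finite cvec \<Rightarrow> ('a \<times> 'p::finite) cvec \<Rightarrow> 'p cvec" where
  "contract_fst x \<psi> = (\<chi> p. \<Sum>a\<in>UNIV. cnj (x $ a) * \<psi> $ (a, p))"

text \<open>The coefficients of \<open>\<psi>\<close> as a map from the first factor to the rest,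
  whose reduced state is this matrix times its adjoint.\<close>

definition amplitude_matrix :: "('a::finite \<times> 'p::finite) cvec \<Rightarrow> complex ^ 'a ^ 'p" where
  "amplitude_matrix \<psi> = (\<chi> p a. \<psi> $ (a, p))"

lemma contract_fst_eq_amplitude: "contract_fst x \<psi> = amplitude_matrix \<psi> *v cnjv x"
  by (simp add: vec_eq_iff contract_fst_def amplitude_matrix_def matrix_vector_mult_def mult.commute)

lemma cnjv_cnjv [simp]: "cnjv (cnjv v) = v"
  by (simp add: vec_eq_iff)

lemma ptrace_fst_projector:
  "ptrace_fst (projector \<psi>) = amplitude_matrix \<psi> ** adjm (amplitude_matrix \<psi>)"
  by (simp add: vec_eq_iff ptrace_fst_def projector_def amplitude_matrix_def matrix_matrix_mult_def)

lemma braket_tensor_vec: "braket (tensor_vec u v) \<phi> = braket v (contract_fst u \<phi>)"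
proof -
  have "braket (tensor_vec u v) \<phi>
      = (\<Sum>i\<in>UNIV. \<Sum>j\<in>UNIV. cnj (v $ j) * (cnj (u $ i) * \<phi> $ (i, j)))"
    by (simp add: braket_def sum_UNIV_prod tensor_vec_def mult_ac)
  also have "\<dots> = (\<Sum>j\<in>UNIV. \<Sum>i\<in>UNIV. cnj (v $ j) * (cnj (u $ i) * \<phi> $ (i, j)))"
    by (rule sum.swap)
  also have "\<dots> = braket v (contract_fst u \<phi>)"
    by (simp add: braket_def contract_fst_def sum_distrib_left)
  finally show ?thesis .
qed

lemma sum_matrix_vector: "(\<Sum>i\<in>S. M i) *v x = (\<Sum>i\<in>S. M i *v x)"
  for M :: "'i \<Rightarrow> complex ^ 'n::finite ^ 'm::finite"
  by (induction S rule: infinite_finite_induct) (simp_all add: matrix_vector_mult_add_rdistrib)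

lemma sum_matrix_mult: "(\<Sum>i\<in>S. M i) ** N = (\<Sum>i\<in>S. M i ** N)"
  for M :: "'i \<Rightarrow> complex ^ 'n::finite ^ 'm::finite"
  by (simp add: vec_eq_iff matrix_matrix_mult_def sum_distrib_right sum.swap[of _ S])

lemma projector_expectation: "braket z (projector s *v z) = of_real ((cmod (braket z s))\<^sup>2)"
proof -
  have "braket z (projector s *v z) = braket z s * cnj (braket z s)"
    by (simp add: projector_mult_vec braket_linear)
  then show ?thesis by (metis complex_norm_square)
qed

lemma trace_projector_mult: "trace (projector z ** M) = braket z (M *v z)"
  by (simp add: projector_eq_outer outer_mult trace_outer braket_adjm')

text \<open>The partial trace is the sum of the projectors of the slices of \<open>\<psi>\<close> at
  fixed \<open>c\<close>, and the overlap with such a slice is component \<open>c\<close> of the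
  doubly contracted vector.\<close>

lemma sdp_value_product:
  fixes \<psi> :: "('a::finite \<times> 'b::finite \<times> 'c::finite) cvec"
  shows "Re (trace (projector (tensor_vec x y) ** ptrace_third (projector \<psi>)))
    = (norm (contract_fst y (contract_fst x \<psi>)))\<^sup>2"
proof -
  define s :: "'c \<Rightarrow> ('a \<times> 'b) cvec" where "s c = (\<chi> p. \<psi> $ (fst p, snd p, c))" for c
  have "ptrace_third (projector \<psi>) = (\<Sum>c\<in>UNIV. projector (s c))"
    by (simp add: vec_eq_iff ptrace_third_def projector_def s_def)
  then have "Re (trace (projector (tensor_vec x y) ** ptrace_third (projector \<psi>)))
      = (\<Sum>c\<in>UNIV. (cmod (braket (tensor_vec x y) (s c)))\<^sup>2)"
    by (simp add: trace_projector_mult sum_matrix_vector braket_sum_right projector_expectation)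
  moreover have "braket (tensor_vec x y) (s c) = contract_fst y (contract_fst x \<psi>) $ c" for c
    unfolding braket_tensor_vec by (simp add: braket_def contract_fst_def s_def)
  ultimately show ?thesis
    by (simp add: norm_vec_def L2_set_def sum_nonneg)
qed

lemma braket_scaleR: "braket (r *\<^sub>R u) v = of_real r * braket u v"
  "braket u (r *\<^sub>R v) = of_real r * braket u v"
  by (simp_all add: braket_def sum_distrib_left) (simp_all add: scaleR_conv_of_real mult_ac)

lemma contract_fst_scaleR: "contract_fst u (r *\<^sub>R \<phi>) = r *\<^sub>R contract_fst u \<phi>"
  by (simp add: vec_eq_iff contract_fst_def scaleR_sum_right)

text \<open>Normalizing the contracted vector gives a second factor whose squared overlap with
  \<open>\<phi>\<close> is the left-hand side.\<close>

lemma contract_fst_le: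
  fixes \<phi> :: "('b::finite \<times> 'c::finite) cvec"
  assumes "norm u = 1"
  shows "(norm (contract_fst u \<phi>))\<^sup>2 \<le> 1 - geom_ent_pure \<phi>"
proof -
  define w where "w = contract_fst u \<phi>"
  \<comment> \<open>If the contraction vanishes, any unit vector serves; \<open>undefined\<close>
    picks an arbitrary axis.\<close>
  define v :: "'c cvec" where "v = (if w = 0 then axis undefined 1 else sgn w)"
  have v: "norm v = 1" by (simp add: v_def norm_sgn)
  have "cmod (braket v w) = norm w"
    by (auto simp: v_def sgn_div_norm braket_scaleR braket_self norm_mult norm_inverse power2_eq_square)
  then have "(norm w)\<^sup>2 \<in> product_overlaps \<phi>"
    unfolding product_overlaps_def using assms v
    by (auto simp: braket_tensor_vec w_def intro!: exI[of _ u] exI[of _ v])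
  then show ?thesis using geom_ent_pure_attained[of \<phi>] by (auto simp: w_def)
qed

lemma contract_fst_ge:
  fixes \<phi> :: "('b::finite \<times> 'c::finite) cvec"
  shows "\<exists>u. norm u = 1 \<and> 1 - geom_ent_pure \<phi> \<le> (norm (contract_fst u \<phi>))\<^sup>2"
proof -
  obtain u v where uv: "norm u = 1" "norm v = 1"
    "geom_ent_pure \<phi> = 1 - (cmod (braket (tensor_vec u v) \<phi>))\<^sup>2"
    using geom_ent_pure_attained[of \<phi>] unfolding product_overlaps_def by auto
  have "cmod (braket v (contract_fst u \<phi>)) \<le> norm (contract_fst u \<phi>)"
    using cmod_braket_le[of v "contract_fst u \<phi>"] uv by simp
  then show ?thesis using uv by (auto simp: braket_tensor_vec power_mono)
qed

lemma contract_fst_le_scaled: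
  fixes \<phi> :: "('b::finite \<times> 'c::finite) cvec"
  assumes "norm u = 1"
  shows "(norm (contract_fst u \<phi>))\<^sup>2 \<le> (norm \<phi>)\<^sup>2 * (1 - geom_ent_pure (sgn \<phi>))"
proof -
  have "contract_fst u \<phi> = norm \<phi> *\<^sub>R contract_fst u (sgn \<phi>)"
    by (cases "\<phi> = 0") (simp_all add: sgn_div_norm flip: contract_fst_scaleR)
  then have "(norm (contract_fst u \<phi>))\<^sup>2 = (norm \<phi>)\<^sup>2 * (norm (contract_fst u (sgn \<phi>)))\<^sup>2"
    by (simp add: power_mult_distrib)
  then show ?thesis
    using mult_left_mono[OF contract_fst_le[OF assms, of "sgn \<phi>"], of "(norm \<phi>)\<^sup>2"] by simp
qed

section \<open>Pure state ensembles and resolutions of the identity\<close>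

lemma trace_sum: "trace (\<Sum>i\<in>S. M i) = (\<Sum>i\<in>S. trace (M i))"
  for M :: "'i \<Rightarrow> complex ^ 'n::finite ^ 'n"
  by (induction S rule: infinite_finite_induct) (simp_all add: trace_add, simp_all add: trace_def)

text \<open>Unnormalized vectors carry their probabilities as squared norms. Zero vectors are
  dropped before normalization, and the rest are renumbered as in
  \<open>pure_decomposition\<close>.\<close>

lemma average_geom_ents_of_family:
  fixes \<phi> :: "'i \<Rightarrow> ('b::finite \<times> 'c::finite) cvec"
  assumes fin: "finite I" and \<rho>: "(\<Sum>i\<in>I. projector (\<phi> i)) = \<rho>" "trace \<rho> = 1"
  shows "(\<Sum>i\<in>I. (norm (\<phi> i))\<^sup>2 * geom_ent_pure (sgn (\<phi> i))) \<in> average_geom_ents \<rho>"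
    and "(\<Sum>i\<in>I. (norm (\<phi> i))\<^sup>2) = 1"
    and "\<exists>n p \<eta>. pure_decomposition \<rho> n p \<eta>"
proof -
  define J where "J = {i \<in> I. \<phi> i \<noteq> 0}"
  have J: "finite J" "J \<subseteq> I" using fin by (auto simp: J_def)
  have restrict: "sum f I = sum f J" if "\<And>i. \<phi> i = 0 \<Longrightarrow> f i = 0" for f :: "'i \<Rightarrow> 'z::comm_monoid_add"
    using fin that by (intro sum.mono_neutral_right) (auto simp: J_def)
  obtain h where h: "bij_betw h {..<card J} J"
    using ex_bij_betw_nat_finite[OF J(1)] by (auto simp: atLeast0LessThan)
  have reindex: "sum f J = (\<Sum>i<card J. f (h i))" for f :: "'i \<Rightarrow> 'z::comm_monoid_add"
    using sum.reindex_bij_betw[OF h] by metis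
  have "Re (trace \<rho>) = (\<Sum>i\<in>I. (norm (\<phi> i))\<^sup>2)"
    by (simp add: trace_sum trace_projector flip: \<rho>(1))
  then show total: "(\<Sum>i\<in>I. (norm (\<phi> i))\<^sup>2) = 1" using \<rho>(2) by simp
  have hJ: "\<phi> (h i) \<noteq> 0" if "i < card J" for i
    using h that by (auto simp: bij_betw_def J_def)
  have "\<rho> = (\<Sum>i<card J. projector (\<phi> (h i)))"
    using \<rho>(1) restrict[of "\<lambda>i. projector (\<phi> i)"] reindex[of "\<lambda>i. projector (\<phi> i)"]
    by (simp add: projector_def vec_eq_iff)
  also have "\<dots> = (\<Sum>i<card J. (norm (\<phi> (h i)))\<^sup>2 *\<^sub>R projector (sgn (\<phi> (h i))))"
    using hJ by (intro sum.cong) (simp_all add: sgn_div_norm projector_scaleR flip: power_mult_distrib)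
  finally have d: "pure_decomposition \<rho> (card J) (\<lambda>i. (norm (\<phi> (h i)))\<^sup>2) (\<lambda>i. sgn (\<phi> (h i)))"
    using total restrict[of "\<lambda>i. (norm (\<phi> i))\<^sup>2"] reindex[of "\<lambda>i. (norm (\<phi> i))\<^sup>2"] hJ
    unfolding pure_decomposition_def by (auto simp: norm_sgn)
  then show "\<exists>n p \<eta>. pure_decomposition \<rho> n p \<eta>" by blast
  have "(\<Sum>i\<in>I. (norm (\<phi> i))\<^sup>2 * geom_ent_pure (sgn (\<phi> i)))
      = (\<Sum>i<card J. (norm (\<phi> (h i)))\<^sup>2 * geom_ent_pure (sgn (\<phi> (h i))))"
    by (subst restrict) (simp_all add: reindex)
  then show "(\<Sum>i\<in>I. (norm (\<phi> i))\<^sup>2 * geom_ent_pure (sgn (\<phi> i))) \<in> average_geom_ents \<rho>"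
    unfolding average_geom_ents_def mem_Collect_eq
    by (intro exI[of _ "card J"] exI[of _ "\<lambda>i. (norm (\<phi> (h i)))\<^sup>2"] exI[of _ "\<lambda>i. sgn (\<phi> (h i))"])
      (simp add: d)
qed

lemma conjugate_sum_projectors:
  fixes K :: "complex ^ 'm::finite ^ 'n::finite"
  shows "K ** (\<Sum>i\<in>S. projector (v i)) ** adjm K = (\<Sum>i\<in>S. projector (K *v v i))"
proof -
  have one: "K ** projector v ** adjm K = projector (K *v v)" for v
    by (simp add: projector_eq_outer mult_outer outer_mult)
  have add: "K ** (M + N) ** adjm K = K ** M ** adjm K + K ** N ** adjm K" for M N
    by (simp add: vec_eq_iff matrix_matrix_mult_def distrib_left distrib_right sum.distrib)
  have zero: "K ** 0 ** adjm K = 0"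
    by (simp add: vec_eq_iff matrix_matrix_mult_def)
  show ?thesis
    by (induction S rule: infinite_finite_induct) (simp_all add: one add zero)
qed

lemma ptrace_snd_product: "ptrace_snd (projector (tensor_vec x y)) = (norm y)\<^sup>2 *\<^sub>R projector x"
proof -
  have "(\<Sum>b\<in>UNIV. x $ i * y $ b * (cnj (x $ j) * cnj (y $ b))) = braket y y * (x $ i * cnj (x $ j))"
    for i j
    unfolding braket_def sum_distrib_right by (rule sum.cong) (simp_all add: mult_ac)
  then show ?thesis
    by (simp add: vec_eq_iff ptrace_snd_def projector_def tensor_vec_def braket_self
        scaleR_conv_of_real[symmetric] flip: of_real_power)
qed

lemma ptrace_snd_sum: "ptrace_snd (\<Sum>i\<in>S. M i) = (\<Sum>i\<in>S. ptrace_snd (M i))"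
  by (simp add: vec_eq_iff ptrace_snd_def sum.swap[of _ S])

lemma ptranspose_snd_sum: "ptranspose_snd (\<Sum>i\<in>S. M i) = (\<Sum>i\<in>S. ptranspose_snd (M i))"
  by (simp add: vec_eq_iff ptranspose_snd_def)

lemma sum_projector_cnjv:
  assumes "(\<Sum>i\<in>S. projector (v i)) = mat 1"
  shows "(\<Sum>i\<in>S. projector (cnjv (v i))) = mat 1"
proof -
  have "(\<Sum>i\<in>S. projector (cnjv (v i))) $ j $ k = cnj (mat 1 $ j $ k)" for j k
    by (simp add: projector_def flip: assms)
  then show ?thesis unfolding vec_eq_iff by (simp only: mat_def) simp
qed

text \<open>By the constraint on the reduced matrix, the first factors of a separable
  \<open>X\<close> resolve the identity, so they steer to an ensemble of \<open>\<rho>\<close>. Each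
  outcome contributes at most its weight times one minus the geometric entanglement of its
  state.\<close>

lemma sdp_value_le:
  fixes \<rho> :: "('b::finite \<times> 'c::finite) cmat" and \<psi> :: "('a::finite \<times> 'b \<times> 'c) cvec"
  assumes dims: "ppt_dims TYPE('a) TYPE('b)" and pur: "is_purification \<psi> \<rho>"
    and tr: "trace \<rho> = 1" and X: "sdp_feasible X"
  shows "Re (trace (X ** ptrace_third (projector \<psi>))) \<le> 1 - geom_ent \<rho>"
proof -
  obtain n :: nat and x y where dec: "X = (\<Sum>i\<in>{1..n}. projector (tensor_vec (x i) (y i)))"
    and y: "\<And>i. i \<in> {1..n} \<Longrightarrow> norm (y i) = 1"
    using ppt_separable[OF dims, of X] X unfolding sdp_feasible_def by blast
  define \<phi> where "\<phi> i = contract_fst (x i) \<psi>" for i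
  have "(\<Sum>i\<in>{1..n}. projector (x i)) = ptrace_snd X"
    unfolding dec ptrace_snd_sum ptrace_snd_product using y by (intro sum.cong) simp_all
  also have "\<dots> = mat 1" using X by (simp add: sdp_feasible_def)
  \<comment> \<open>The conjugates appear because \<open>contract_fst\<close> is antilinear in its
    first argument.\<close>
  finally have one: "(\<Sum>i\<in>{1..n}. projector (cnjv (x i))) = mat 1" by (rule sum_projector_cnjv)
  have \<rho>: "(\<Sum>i\<in>{1..n}. projector (\<phi> i)) = \<rho>"
    unfolding \<phi>_def contract_fst_eq_amplitude conjugate_sum_projectors[symmetric] one
    using pur by (simp add: is_purification_def ptrace_fst_projector)
  note fam = average_geom_ents_of_family[OF finite_atLeastAtMost \<rho> tr]
  obtain m p \<eta> where "pure_decomposition \<rho> m p \<eta>" using fam(3) by blast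
  then have le: "geom_ent \<rho> \<le> (\<Sum>i\<in>{1..n}. (norm (\<phi> i))\<^sup>2 * geom_ent_pure (sgn (\<phi> i)))"
    using geom_ent_attained fam(1) by blast
  have "Re (trace (X ** ptrace_third (projector \<psi>)))
      = (\<Sum>i\<in>{1..n}. (norm (contract_fst (y i) (\<phi> i)))\<^sup>2)"
    unfolding dec \<phi>_def sum_matrix_mult trace_sum Re_sum sdp_value_product ..
  also have "\<dots> \<le> (\<Sum>i\<in>{1..n}. (norm (\<phi> i))\<^sup>2 * (1 - geom_ent_pure (sgn (\<phi> i))))"
    using y by (intro sum_mono contract_fst_le_scaled) blast
  also have "\<dots> = 1 - (\<Sum>i\<in>{1..n}. (norm (\<phi> i))\<^sup>2 * geom_ent_pure (sgn (\<phi> i)))"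
    by (simp only: right_diff_distrib sum_subtractf mult_1_right fam(2))
  finally show ?thesis using le by linarith
qed

text \<open>A nonzero kernel vector would put one of the vectors \<open>c a\<close> into the span of
  the others. These vectors span the rows of the reduced matrix, whose rank would then be less than
  the dimension of the first factor.\<close>

lemma amplitude_matrix_injective:
  fixes \<psi> :: "('a::finite \<times> 'p::finite) cvec"
  assumes rank: "rank (ptrace_fst (projector \<psi>)) = CARD('a)"
    and ker: "amplitude_matrix \<psi> *v x = 0"
  shows "x = 0"
proof (rule ccontr)
  assume "x \<noteq> 0"
  then obtain a0 where a0: "x $ a0 \<noteq> 0" by (auto simp: vec_eq_iff)
  define c where "c a = (\<chi> p. cnj (\<psi> $ (a, p)))" for a
  define S where "S = c ` (UNIV - {a0})"
  have "(\<Sum>a\<in>UNIV. cnj (x $ a) *s c a) = 0"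
    using arg_cong[OF ker, of cnjv]
    by (simp add: vec_eq_iff c_def amplitude_matrix_def matrix_vector_mult_def mult.commute)
  then have "cnj (x $ a0) *s c a0 + (\<Sum>a\<in>UNIV - {a0}. cnj (x $ a) *s c a) = 0"
    by (subst (asm) sum.remove[of _ a0]) simp_all
  then have "cnj (x $ a0) *s c a0 = - (\<Sum>a\<in>UNIV - {a0}. cnj (x $ a) *s c a)"
    by (simp add: add_eq_0_iff2)
  moreover have "- (\<Sum>a\<in>UNIV - {a0}. cnj (x $ a) *s c a) \<in> vec.span S"
    by (intro vec.span_neg vec.span_sum vec.span_scale vec.span_base) (auto simp: S_def)
  ultimately have "cnj (x $ a0) *s c a0 \<in> vec.span S" by simp
  then have "inverse (cnj (x $ a0)) *s (cnj (x $ a0) *s c a0) \<in> vec.span S"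
    by (rule vec.span_scale)
  then have "c a0 \<in> vec.span S" using a0 by simp
  then have c: "c a \<in> vec.span S" for a
    by (cases "a = a0") (auto simp: S_def intro: vec.span_base)
  have "rows (ptrace_fst (projector \<psi>)) \<subseteq> vec.span S"
  proof
    fix r assume "r \<in> rows (ptrace_fst (projector \<psi>))"
    then obtain p where "r = row p (ptrace_fst (projector \<psi>))" by (auto simp: rows_def)
    then have "r = (\<Sum>a\<in>UNIV. \<psi> $ (a, p) *s c a)"
      by (simp add: vec_eq_iff row_def ptrace_fst_def projector_def c_def)
    then show "r \<in> vec.span S" using c by (auto intro!: vec.span_sum vec.span_scale)
  qed
  then have "rank (ptrace_fst (projector \<psi>)) \<le> card S"
    unfolding row_rank_def_gen by (rule vec.dim_le_card) (simp add: S_def)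
  also have "\<dots> \<le> card (UNIV - {a0})" unfolding S_def by (rule card_image_le) simp
  also have "\<dots> < CARD('a)" by (intro psubset_card_mono) auto
  finally show False using rank by simp
qed

text \<open>Pull the ensemble back by a left inverse \<open>L\<close> of \<open>K\<close>. Each
  \<open>\<phi> i\<close> lies in the range of \<open>K\<close>: the matrix E = 1 - K L kills that
  range, so the squared norms of the \<open>E *v \<phi> i\<close> sum to zero.\<close>

lemma decomposition_from_povm:
  fixes K :: "complex ^ 'a::finite ^ 'p::finite" and \<phi> :: "'i \<Rightarrow> 'p cvec"
  assumes inj: "\<And>x. K *v x = 0 \<Longrightarrow> x = 0" and fin: "finite I"
    and dec: "(\<Sum>i\<in>I. projector (\<phi> i)) = K ** adjm K"
  shows "\<exists>v. (\<Sum>i\<in>I. projector (v i)) = mat 1 \<and> (\<forall>i\<in>I. K *v v i = \<phi> i)"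
proof -
  obtain L where L: "L ** K = mat 1"
    using inj matrix_left_invertible_ker[of K] by blast
  have "(\<Sum>i\<in>I. projector (L *v \<phi> i)) = L ** (K ** adjm K) ** adjm L"
    by (simp add: conjugate_sum_projectors flip: dec)
  also have "\<dots> = (L ** K) ** adjm (L ** K)" by (simp add: adjm_mult matrix_mul_assoc)
  finally have 1: "(\<Sum>i\<in>I. projector (L *v \<phi> i)) = mat 1" by (simp add: L)
  define E where "E = mat 1 - K ** L"
  have "E ** K = 0"
    by (simp add: E_def matrix_sub_rdistrib L flip: matrix_mul_assoc)
  then have E0: "E *v (K *v u) = 0" for u by (simp add: matrix_vector_mul_assoc)
  have "(\<Sum>i\<in>I. projector (E *v \<phi> i)) = (E ** K) ** adjm (E ** K)"
    unfolding conjugate_sum_projectors[symmetric] dec by (simp add: adjm_mult matrix_mul_assoc)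
  also have "\<dots> = 0" unfolding \<open>E ** K = 0\<close> by (simp add: matrix_matrix_mult_def vec_eq_iff)
  finally have zero: "(\<Sum>i\<in>I. projector (E *v \<phi> i)) = 0" .
  have "Re (trace (\<Sum>i\<in>I. projector (E *v \<phi> i))) = 0"
    unfolding zero by (simp add: trace_def)
  then have "(\<Sum>i\<in>I. (norm (E *v \<phi> i))\<^sup>2) = 0"
    by (simp add: trace_sum trace_projector)
  then have "E *v \<phi> i = 0" if "i \<in> I" for i
    using that fin by (simp add: sum_nonneg_eq_0_iff)
  then have "K *v (L *v \<phi> i) = \<phi> i" if "i \<in> I" for i
    using that by (simp add: E_def matrix_vector_mult_diff_rdistrib matrix_vector_mul_assoc)
  then show ?thesis using 1 by (intro exI[of _ "\<lambda>i. L *v \<phi> i"]) simp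
qed

text \<open>An optimal ensemble of \<open>\<rho>\<close> comes from a resolution of the identity on
  the purifying system. Attaching to each outcome its best vector \<open>u i\<close> gives a
  separable feasible matrix that reaches the bound.\<close>

lemma sdp_value_attained:
  fixes \<rho> :: "('b::finite \<times> 'c::finite) cmat" and \<psi> :: "('a::finite \<times> 'b \<times> 'c) cvec"
  assumes pur: "is_purification \<psi> \<rho>" and rank: "CARD('a) = rank \<rho>" and tr: "trace \<rho> = 1"
  shows "\<exists>X. sdp_feasible X \<and> 1 - geom_ent \<rho> \<le> Re (trace (X ** ptrace_third (projector \<psi>)))"
proof -
  define K where "K = amplitude_matrix \<psi>"
  have \<rho>: "\<rho> = K ** adjm K"
    using pur by (simp add: K_def is_purification_def ptrace_fst_projector)
  have "(K *v axis a 1) $ q = K $ q $ a" for a q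
    using braket_axis_matrix[of q K a] by (simp add: braket_axis)
  \<comment> \<open>The columns of \<open>K\<close> provide one decomposition, so the infimum in
    \<open>geom_ent\<close> is attained.\<close>
  then have "(\<Sum>a\<in>UNIV. projector (K *v axis a 1)) = \<rho>"
    by (simp add: \<rho> vec_eq_iff projector_def matrix_matrix_mult_def)
  then obtain m q \<xi> where "pure_decomposition \<rho> m q \<xi>"
    using average_geom_ents_of_family(3)[of UNIV "\<lambda>a. K *v axis a 1" \<rho>] tr by auto
  then have "geom_ent \<rho> \<in> average_geom_ents \<rho>" using geom_ent_attained by blast
  then obtain n p \<eta> where d: "pure_decomposition \<rho> n p \<eta>"
    and g: "geom_ent \<rho> = (\<Sum>i<n. p i * geom_ent_pure (\<eta> i))"
    unfolding average_geom_ents_def by blast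
  have p: "p i \<ge> 0" if "i < n" for i using d that by (simp add: pure_decomposition_def)
  define \<phi> where "\<phi> i = sqrt (p i) *\<^sub>R \<eta> i" for i
  have "(\<Sum>i<n. projector (\<phi> i)) = K ** adjm K"
    using d p by (simp add: \<phi>_def projector_scaleR pure_decomposition_def flip: \<rho>)
  moreover have "x = 0" if "K *v x = 0" for x
    using amplitude_matrix_injective[of \<psi> x] that pur rank by (simp add: K_def is_purification_def)
  ultimately obtain v where v: "(\<Sum>i<n. projector (v i)) = mat 1"
    and Kv: "\<And>i. i < n \<Longrightarrow> K *v v i = \<phi> i"
    using decomposition_from_povm[of K "{..<n}" \<phi>] by auto
  obtain u where u: "\<And>i. norm (u i) = 1"
    "\<And>i. 1 - geom_ent_pure (\<eta> i) \<le> (norm (contract_fst (u i) (\<eta> i)))\<^sup>2"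
  proof -
    have "\<forall>i. \<exists>u. norm u = 1 \<and> 1 - geom_ent_pure (\<eta> i) \<le> (norm (contract_fst u (\<eta> i)))\<^sup>2"
      by (intro allI contract_fst_ge)
    then show ?thesis using that by metis
  qed
  \<comment> \<open>Products make both positivity conditions immediate; \<open>cnjv\<close> undoes
    the conjugation in \<open>contract_fst\<close>.\<close>
  define X where "X = (\<Sum>i<n. projector (tensor_vec (cnjv (v i)) (u i)))"
  have "sdp_feasible X"
    unfolding sdp_feasible_def
  proof (intro conjI)
    show "psd X" unfolding X_def by (intro psd_sum psd_projector)
    show "psd (ptranspose_snd X)"
      unfolding X_def ptranspose_snd_sum ptranspose_projector by (intro psd_sum psd_projector)
    show "ptrace_snd X = mat 1"
      unfolding X_def ptrace_snd_sum ptrace_snd_product using sum_projector_cnjv[OF v] u by simp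
  qed
  moreover have "1 - geom_ent \<rho> \<le> Re (trace (X ** ptrace_third (projector \<psi>)))"
  proof -
    have "1 - geom_ent \<rho> = (\<Sum>i<n. p i * (1 - geom_ent_pure (\<eta> i)))"
      using d unfolding g pure_decomposition_def by (simp add: right_diff_distrib sum_subtractf)
    also have "\<dots> \<le> (\<Sum>i<n. p i * (norm (contract_fst (u i) (\<eta> i)))\<^sup>2)"
      using u p by (intro sum_mono mult_left_mono) auto
    also have "\<dots> = (\<Sum>i<n. (norm (contract_fst (u i) (contract_fst (cnjv (v i)) \<psi>)))\<^sup>2)"
    proof (rule sum.cong)
      fix i assume "i \<in> {..<n}"
      then have "contract_fst (cnjv (v i)) \<psi> = sqrt (p i) *\<^sub>R \<eta> i"
        using Kv by (simp add: contract_fst_eq_amplitude \<phi>_def flip: K_def)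
      then show "p i * (norm (contract_fst (u i) (\<eta> i)))\<^sup>2
          = (norm (contract_fst (u i) (contract_fst (cnjv (v i)) \<psi>)))\<^sup>2"
        using p \<open>i \<in> {..<n}\<close> by (simp add: contract_fst_scaleR power_mult_distrib)
    qed simp
    also have "\<dots> = Re (trace (X ** ptrace_third (projector \<psi>)))"
      unfolding X_def sum_matrix_mult trace_sum Re_sum sdp_value_product ..
    finally show ?thesis .
  qed
  ultimately show ?thesis by blast
qed

theorem mainTheorem7:
  fixes \<rho> :: "('b::finite \<times> 'c::finite) cmat"
    and \<psi> :: "('a::finite \<times> 'b \<times> 'c) cvec"
  assumes "quantum_state \<rho>"
    and "(CARD('b) = 3 \<and> rank \<rho> \<le> 2) \<or> (CARD('b) = 2 \<and> rank \<rho> \<le> 3)"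
    and "is_purification \<psi> \<rho>"
    and "CARD('a) = rank \<rho>"
  shows "\<exists>X. is_arg_max (\<lambda>X. Re (trace (X ** ptrace_third (projector \<psi>)))) sdp_feasible X \<and>
             geom_ent \<rho> = 1 - Re (trace (X ** ptrace_third (projector \<psi>)))"
proof -
  have tr: "trace \<rho> = 1" using assms(1) by (simp add: quantum_state_def)
  \<comment> \<open>Types are nonempty, so the rank is at least 1; rank one with a qutrit falls
    under the first alternative of \<open>ppt_dims\<close>.\<close>
  have "CARD('a) \<noteq> 0" by simp
  then have dims: "ppt_dims TYPE('a) TYPE('b)"
    using assms(2,4) unfolding ppt_dims_def by linarith
  obtain X where X: "sdp_feasible X"
    "1 - geom_ent \<rho> \<le> Re (trace (X ** ptrace_third (projector \<psi>)))"
    using sdp_value_attained[OF assms(3,4) tr] by blast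
  note le = sdp_value_le[OF dims assms(3) tr]
  have "geom_ent \<rho> = 1 - Re (trace (X ** ptrace_third (projector \<psi>)))"
    using X(2) le[OF X(1)] by linarith
  moreover have "is_arg_max (\<lambda>X. Re (trace (X ** ptrace_third (projector \<psi>)))) sdp_feasible X"
    unfolding is_arg_max_def using X le by force
  ultimately show ?thesis by blast
qed

end
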